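(* Let $n\ge 2$, let $c\ge 1$, let $D\subset\mathbb{R}^n$ be an unbounded $c$-John domain, let $\tau,\delta\in(0,1)$, and let $1\le p<n/\delta$. Then there is a constant $C=C(\delta,\tau,p,n,c)>0$, depending only on the quantities $\delta,\tau,p,n,c$, such that the inequality $$\inf_{a\in\mathbb{R}}\int_D |u(x)-a|^{np/(n-\delta p)}\,dx\le C\,|u|_{W^{\delta,p}_\tau(D)}^{np/(n-\delta p)}$$ holds for each $u\in\dot{W}^{\delta,p}_\tau(D)$.
   Context: A domain $D$ in $\mathbb{R}^n$ with $n\ge2$ is a $c$-John domain, $c\ge1$, if each pair of points $x_1,x_2\in D$ can be joined by a rectifiable curve $\gamma:[0,\ell]\to D$ parametrized by its arc length (so $\gamma(0)=x_1$, $\gamma(\ell)=x_2$) such that $\mathrm{dist}(\gamma(t),\partial D)\ge\min\{t,\ell-t\}/c$ for every $t\in[0,\ell]$. Unbounded domains, including $\mathbb{R}^n$, are allowed. $B^n(x,r)$ is the open ball with center $x$ and radius $r$. For an open set $G\subset\mathbb{R}^n$, $0<p<\infty$, $0<\tau,\delta<1$ and a measurable $u:G\to\mathbb{R}$, $$|u|_{W^{\delta,p}_\tau(G)}=\Big(\int_G\int_{B^n(x,\tau\,\mathrm{dist}(x,\partial G))}\frac{|u(x)-u(y)|^p}{|x-y|^{n+\delta p}}\,dy\,dx\Big)^{1/p};$$ when $G=\mathbb{R}^n$ both integrals are taken over the whole space. The homogeneous fractional Sobolev space $\dot{W}^{\delta,p}_\tau(G)$ consists of all measurable $u:G\to\mathbb{R}$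 with $|u|_{W^{\delta,p}_\tau(G)}<\infty$. *)

theory Defs
  imports "HOL-Analysis.Analysis"
begin

(* dist(x, boundary of G). Extended-real valued, so that the distance to an empty boundary
   (G the whole space) is infinite, whereas infdist x {} = 0. *)
definition boundary_dist :: "'a::metric_space set \<Rightarrow> 'a \<Rightarrow> ereal" where
  "boundary_dist G x = (if frontier G = {} then \<infinity> else ereal (infdist x (frontier G)))"

(* The supremum of the lengths of inscribed polygons s 0 \<le> ... \<le> s k in [a,b]. *)
definition curve_length :: "(real \<Rightarrow> 'a::metric_space) \<Rightarrow> real \<Rightarrow> real \<Rightarrow> ennreal" where
  "curve_length \<gamma> a b =
     (SUP (k, s) \<in> {(k::nat, s::nat \<Rightarrow> real). mono_on {..k} s \<and> s ` {..k} \<subseteq> {a..b}}.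
        \<Sum>i<k. ennreal (dist (\<gamma> (s i)) (\<gamma> (s (Suc i)))))"

definition arc_length_param :: "(real \<Rightarrow> 'a::metric_space) \<Rightarrow> real \<Rightarrow> bool" where
  "arc_length_param \<gamma> l \<longleftrightarrow>
     0 \<le> l \<and> continuous_on {0..l} \<gamma> \<and> (\<forall>t\<in>{0..l}. curve_length \<gamma> 0 t = ennreal t)"

definition john_domain :: "real \<Rightarrow> 'a::euclidean_space set \<Rightarrow> bool" where
  "john_domain c D \<longleftrightarrow>
     1 \<le> c \<and> open D \<and> connected D \<and> D \<noteq> {} \<and>
     (\<forall>x1\<in>D. \<forall>x2\<in>D. \<exists>\<gamma> l. arc_length_param \<gamma> l \<and> \<gamma> ` {0..l} \<subseteq> D \<and> \<gamma> 0 = x1 \<and> \<gamma> l = x2 \<and>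
        (\<forall>t\<in>{0..l}. ereal (min t (l - t) / c) \<le> boundary_dist D (\<gamma> t)))"

(* The p-th power of the seminorm. For G = UNIV and \<tau> > 0 the inner domain of integration is
   all of UNIV; for any other nonempty open G it is ball x (\<tau> * infdist x (frontier G)).
   For x in G and \<tau> < 1 it is contained in G, so only the values of u on G matter. *)
definition frac_energy ::
    "real \<Rightarrow> real \<Rightarrow> real \<Rightarrow> 'a::euclidean_space set \<Rightarrow> ('a \<Rightarrow> real) \<Rightarrow> ennreal" where
  "frac_energy \<delta> p \<tau> G u =
     (\<integral>\<^sup>+x\<in>G. (\<integral>\<^sup>+y\<in>{y. ereal (dist x y) < ereal \<tau> * boundary_dist G x}.
         ennreal (\<bar>u x - u y\<bar> powr p / norm (x - y) powr (real DIM('a) + \<delta> * p))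
       \<partial>lebesgue) \<partial>lebesgue)"

definition frac_seminorm ::
    "real \<Rightarrow> real \<Rightarrow> real \<Rightarrow> 'a::euclidean_space set \<Rightarrow> ('a \<Rightarrow> real) \<Rightarrow> ennreal" where
  "frac_seminorm \<delta> p \<tau> G u =
     (if frac_energy \<delta> p \<tau> G u = \<infinity> then \<infinity>
      else ennreal (enn2real (frac_energy \<delta> p \<tau> G u) powr (1 / p)))"

definition frac_sobolev ::
    "real \<Rightarrow> real \<Rightarrow> real \<Rightarrow> 'a::euclidean_space set \<Rightarrow> ('a \<Rightarrow> real) set" where
  "frac_sobolev \<delta> p \<tau> G =
     {u. u \<in> borel_measurable (lebesgue_on G) \<and> frac_seminorm \<delta> p \<tau> G u < \<infinity>}"

end

theory Submission
  imports Defs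
begin

text \<open>Let $d(x)$ be the distance to the boundary, $g(x)$ the inner integral of the energy, so that
  the $p$-th power of the seminorm is $e = \int_D g$, and $q = np/(n - \delta p)$,
  $\sigma = n/p - \delta$. The proof compares \<open>u\<close> with its medians on balls and ends with an
  optimisation of Hedberg's type, but no maximal function occurs, so that $p = 1$ is not special.

  A median $m_B$ of \<open>u\<close> on a ball \<open>B\<close> satisfies $|m_B - b|^p\,|B| \le 2\int_B |u - b|^p$ for every
  real \<open>b\<close> (\<open>median_deviation\<close>). Applied twice, this bounds the difference of the medians on two
  balls of radius about \<open>s\<close>, whose points are close to each other compared with \<open>d\<close>, by
  $|m_B - m_{B'}|^p \le C s^{\delta p - n}\int_B g$ (\<open>step_le\<close>).

  Since \<open>D\<close> is unbounded, the first halves of John curves lead from each \<open>x\<close> in \<open>D\<close> to arbitrarily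
  large distances, and at arc length \<open>s\<close> such a curve has distance at least $s/c$ from the boundary.
  Let $f(s)$ be the median of \<open>u\<close> on the ball of radius $\epsilon s$ about the point of parameter \<open>s\<close>.
  The differences of \<open>f\<close> are telescoped along a geometric sequence of parameters, with two bounds
  for the integral of \<open>g\<close> over a ball:

  \<^item> It is at most \<open>e\<close>. The differences then decay like $s^{-\sigma}$, and upward telescoping gives
    $|f(R) - f(S)| \le C e^{1/p} R^{-\sigma}$ for $R \le S$ (\<open>median_path_decay\<close>).

  \<^item> For \<open>s\<close> at least a multiple of $d(x)$ it is at most $C s^n h(x)$, where
    $h(x) = \int g(y)\,d(y)^{-n}\,dy$ over all \<open>y\<close> with $|x - y| \le 4K d(y)$. Downward telescoping,
    and a direct comparison of $u(x)$ with $f(s)$ for small \<open>s\<close>, give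
    $|u(x) - f(R)| \le C R^\delta (g(x) + h(x))^{1/p}$ (\<open>value_median_path\<close>). By Tonelli's theorem
    $\int_D h \le C e$ (\<open>integral_far_energy\<close>).

  Two points reached at arc length \<open>T\<close> are joined by a further John curve. Moving from both of its
  ends to its midpoint with balls of radius about $T + t$ shows that the two medians differ by at
  most $C e^{1/p} T^{-\sigma}$, however long the curve is (\<open>john_join\<close>, \<open>median_join\<close>). Hence the
  medians have a common limit point \<open>a\<close>, and for almost every \<open>x\<close> in \<open>D\<close> and all $R > 0$
  \[ |u(x) - a| \le C\,(R^\delta (g(x) + h(x))^{1/p} + R^{-\sigma} e^{1/p}) \]
  (\<open>pointwise_bound\<close>). The best \<open>R\<close> yields $|u(x) - a|^q \le C e^{\delta q/n} (g(x) + h(x))$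
  (\<open>powr_optimisation\<close>), and integration over \<open>D\<close> gives the claim, as $\delta q/n + 1 = q/p$.\<close>

section \<open>Medians\<close>

definition is_median :: "('a::euclidean_space \<Rightarrow> real) \<Rightarrow> 'a set \<Rightarrow> real \<Rightarrow> bool" where
  "is_median u B m \<longleftrightarrow>
     emeasure lborel B \<le> 2 * emeasure lborel {y \<in> B. u y \<le> m} \<and>
     emeasure lborel B \<le> 2 * emeasure lborel {y \<in> B. m \<le> u y}"

definition median :: "('a::euclidean_space \<Rightarrow> real) \<Rightarrow> 'a set \<Rightarrow> real" where
  "median u B = (SOME m. is_median u B m)"

text \<open>The infimum of all \<open>t\<close> for which $\{u \le t\}$ carries at least half of the measure is a median:
  continuity of the measure from above gives one half, continuity from below the other.\<close>
lemma median_exists: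
  fixes u :: "'a::euclidean_space \<Rightarrow> real"
  assumes [measurable]: "u \<in> borel_measurable borel" "B \<in> sets borel"
    and fin: "emeasure lborel B < \<infinity>"
  shows "\<exists>m. is_median u B m"
proof (cases "emeasure lborel B = 0")
  case True
  then show ?thesis by (simp add: is_median_def)
next
  case False
  define b where "b = measure lborel B"
  have bB: "emeasure lborel B = ennreal b"
    unfolding b_def using fin by (simp add: emeasure_eq_ennreal_measure)
  have b0: "0 < b"
    using False bB by (metis ennreal_0 b_def less_eq_real_def measure_nonneg)
  define F where "F t = measure lborel {y \<in> B. u y \<le> t}" for t
  have sub_fin: "emeasure lborel A \<noteq> \<infinity>" if "A \<subseteq> B" "A \<in> sets borel" for A
    using emeasure_mono[of A B lborel] that assms(2) fin by (auto simp: top_unique)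
  have F_em: "emeasure lborel {y \<in> B. u y \<le> t} = ennreal (F t)" for t
    unfolding F_def using sub_fin[of "{y \<in> B. u y \<le> t}"] by (simp add: emeasure_eq_ennreal_measure)
  have F_mono: "F s \<le> F t" if "s \<le> t" for s t
  proof -
    have "ennreal (F s) \<le> ennreal (F t)"
      unfolding F_em[symmetric] using that by (intro emeasure_mono) auto
    then show ?thesis by (simp add: F_def)
  qed
  have up: "(\<lambda>k. F (real k)) \<longlonglongrightarrow> b"
  proof -
    have "(\<lambda>k. measure lborel {y \<in> B. u y \<le> real k}) \<longlonglongrightarrow> measure lborel (\<Union>k. {y \<in> B. u y \<le> real k})"
    proof (rule Lim_measure_incseq)
      have "(\<Union>k. {y \<in> B. u y \<le> real k}) \<subseteq> B" by auto
      then show "emeasure lborel (\<Union>k. {y \<in> B. u y \<le> real k}) \<noteq> \<infinity>"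
        by (rule sub_fin) measurable
    qed (auto simp: incseq_def)
    also have "(\<Union>k. {y \<in> B. u y \<le> real k}) = B" using real_arch_simple by fast
    finally show ?thesis by (simp add: F_def b_def)
  qed
  have dn: "(\<lambda>k. F (- real k)) \<longlonglongrightarrow> 0"
  proof -
    have "(\<lambda>k. measure lborel {y \<in> B. u y \<le> - real k}) \<longlonglongrightarrow> measure lborel (\<Inter>k. {y \<in> B. u y \<le> - real k})"
    proof (rule Lim_measure_decseq)
      show "emeasure lborel {y \<in> B. u y \<le> - real k} \<noteq> \<infinity>" for k
        by (rule sub_fin, blast) measurable
    qed (auto simp: decseq_def)
    also have "(\<Inter>k. {y \<in> B. u y \<le> - real k}) = {}"
    proof -
      have "\<exists>k. - real k < u y" for y
        using reals_Archimedean2[of "- u y"] by (metis minus_less_iff)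
      then show ?thesis by (auto simp: not_le[symmetric])
    qed
    finally show ?thesis by (simp add: F_def)
  qed
  define S where "S = {t. b \<le> 2 * F t}"
  have "\<forall>\<^sub>F k in sequentially. b / 2 < F (real k)"
    using order_tendstoD(1)[OF up, of "b / 2"] b0 by simp
  then obtain j where "b / 2 < F (real j)" by (rule eventually_happens'[OF sequentially_bot, THEN exE])
  then have "real j \<in> S" by (simp add: S_def)
  then have S_ne: "S \<noteq> {}" by blast
  have "\<forall>\<^sub>F k in sequentially. F (- real k) < b / 2"
    using order_tendstoD(2)[OF dn, of "b / 2"] b0 by simp
  then obtain k where k: "F (- real k) < b / 2" by (rule eventually_happens'[OF sequentially_bot, THEN exE])
  have S_low: "- real k \<le> t" if "t \<in> S" for t
    using k F_mono[of t "- real k"] that unfolding S_def by (cases "t \<le> - real k") auto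
  then have S_bdd: "bdd_below S" by (meson bdd_belowI)
  define m where "m = Inf S"
  have above: "b \<le> 2 * F t" if "m < t" for t
  proof -
    have "\<exists>s\<in>S. s < t" using that cInf_less_iff[OF S_ne S_bdd, of t] by (simp add: m_def)
    then obtain s where "s \<in> S" "s < t" by blast
    then show ?thesis using F_mono[of s t] unfolding S_def by auto
  qed
  have below: "2 * F t < b" if "t < m" for t
    using that cInf_lower[OF _ S_bdd, of t] unfolding m_def S_def by fastforce
  have inv_mono: "1 / real (Suc l) \<le> 1 / real (Suc k)" if "k \<le> l" for k l
    using that by (simp add: frac_le)
  have "b \<le> 2 * F m"
  proof -
    have "(\<lambda>k. measure lborel {y \<in> B. u y \<le> m + 1 / real (Suc k)}) \<longlonglongrightarrow>
        measure lborel (\<Inter>k. {y \<in> B. u y \<le> m + 1 / real (Suc k)})"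
    proof (rule Lim_measure_decseq)
      show "emeasure lborel {y \<in> B. u y \<le> m + 1 / real (Suc k)} \<noteq> \<infinity>" for k
        by (rule sub_fin, blast) measurable
      show "decseq (\<lambda>k. {y \<in> B. u y \<le> m + 1 / real (Suc k)})"
        unfolding decseq_def
      proof safe
        fix k l y assume "k \<le> l" "u y \<le> m + 1 / real (Suc l)"
        then show "u y \<le> m + 1 / real (Suc k)" using inv_mono[of k l] by linarith
      qed
    qed auto
    also have "(\<Inter>k. {y \<in> B. u y \<le> m + 1 / real (Suc k)}) = {y \<in> B. u y \<le> m}"
    proof -
      have "u y \<le> m" if *: "\<And>k. u y \<le> m + 1 / real (Suc k)" for y
      proof (rule field_le_epsilon)
        fix e :: real assume "0 < e"
        then obtain k where "1 / real (Suc k) < e" using nat_approx_posE by blast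
        then show "u y \<le> m + e" using *[of k] by (meson add_le_cancel_left less_imp_le order_trans)
      qed
      then show ?thesis by (auto intro: order_trans)
    qed
    finally have "(\<lambda>k. 2 * F (m + 1 / real (Suc k))) \<longlonglongrightarrow> 2 * F m"
      unfolding F_def by (intro tendsto_intros)
    then show ?thesis by (rule LIMSEQ_le_const) (auto intro!: above)
  qed
  moreover have "2 * measure lborel {y \<in> B. u y < m} \<le> b"
  proof -
    have "(\<lambda>k. measure lborel {y \<in> B. u y \<le> m - 1 / real (Suc k)}) \<longlonglongrightarrow>
        measure lborel (\<Union>k. {y \<in> B. u y \<le> m - 1 / real (Suc k)})"
    proof (rule Lim_measure_incseq)
      have "(\<Union>k. {y \<in> B. u y \<le> m - 1 / real (Suc k)}) \<subseteq> B" by auto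
      then show "emeasure lborel (\<Union>k. {y \<in> B. u y \<le> m - 1 / real (Suc k)}) \<noteq> \<infinity>"
        by (rule sub_fin) measurable
      show "incseq (\<lambda>k. {y \<in> B. u y \<le> m - 1 / real (Suc k)})"
        unfolding incseq_def
      proof safe
        fix k l y assume "k \<le> l" "u y \<le> m - 1 / real (Suc k)"
        then show "u y \<le> m - 1 / real (Suc l)" using inv_mono[of k l] by linarith
      qed
    qed auto
    also have "(\<Union>k. {y \<in> B. u y \<le> m - 1 / real (Suc k)}) = {y \<in> B. u y < m}"
    proof -
      have "\<exists>k. u y \<le> m - 1 / real (Suc k)" if "u y < m" for y
      proof -
        have "0 < m - u y" using that by simp
        then obtain k where "1 / real (Suc k) < m - u y" by (rule nat_approx_posE)
        then show ?thesis by (intro exI[of _ k]) linarith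
      qed
      moreover have "u y < m" if "u y \<le> m - 1 / real (Suc k)" for y k
      proof -
        have "0 < 1 / real (Suc k)" by simp
        then show ?thesis using that by linarith
      qed
      ultimately show ?thesis by blast
    qed
    finally have "(\<lambda>k. 2 * F (m - 1 / real (Suc k))) \<longlonglongrightarrow> 2 * measure lborel {y \<in> B. u y < m}"
      unfolding F_def by (intro tendsto_intros)
    then show ?thesis by (rule LIMSEQ_le_const2) (auto intro!: less_imp_le below)
  qed
  moreover have "measure lborel {y \<in> B. m \<le> u y} = b - measure lborel {y \<in> B. u y < m}"
  proof -
    have "measure lborel (B - {y \<in> B. u y < m}) = b - measure lborel {y \<in> B. u y < m}"
      unfolding b_def by (rule measure_Diff) (use fin in auto)
    moreover have "B - {y \<in> B. u y < m} = {y \<in> B. m \<le> u y}" by auto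
    ultimately show ?thesis by simp
  qed
  ultimately have "b \<le> 2 * F m" "b \<le> 2 * measure lborel {y \<in> B. m \<le> u y}" by auto
  moreover have "emeasure lborel {y \<in> B. m \<le> u y} = ennreal (measure lborel {y \<in> B. m \<le> u y})"
    using sub_fin[of "{y \<in> B. m \<le> u y}"] by (simp add: emeasure_eq_ennreal_measure)
  ultimately have "is_median u B m"
    unfolding is_median_def bB F_em
    by (simp add: ennreal_numeral[symmetric] ennreal_mult[symmetric] F_def del: ennreal_numeral)
  then show ?thesis ..
qed

text \<open>On the side of the median away from \<open>b\<close>, which carries at least half of the measure of \<open>B\<close>, the
  function deviates from \<open>b\<close> at least as much as the median does. Averages would satisfy a similar
  estimate, but only for integrable functions and by way of Jensen's inequality.\<close>
lemma median_deviation: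
  fixes u :: "'a::euclidean_space \<Rightarrow> real"
  assumes [measurable]: "u \<in> borel_measurable borel" "B \<in> sets borel"
    and fin: "emeasure lborel B < \<infinity>" and p: "0 \<le> p"
  shows "ennreal (\<bar>median u B - b\<bar> powr p) * emeasure lborel B
         \<le> 2 * (\<integral>\<^sup>+y\<in>B. ennreal (\<bar>u y - b\<bar> powr p) \<partial>lborel)"
proof -
  let ?m = "median u B"
  have med: "is_median u B ?m"
    unfolding median_def using someI_ex[OF median_exists[OF assms(1-3)]] .
  have half: "ennreal (\<bar>?m - b\<bar> powr p) * emeasure lborel A
      \<le> (\<integral>\<^sup>+y\<in>B. ennreal (\<bar>u y - b\<bar> powr p) \<partial>lborel)"
    if [measurable]: "A \<in> sets borel" and A: "A \<subseteq> B" "\<And>y. y \<in> A \<Longrightarrow> \<bar>?m - b\<bar> \<le> \<bar>u y - b\<bar>" for A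
  proof -
    have "ennreal (\<bar>?m - b\<bar> powr p) * emeasure lborel A
        = (\<integral>\<^sup>+y. ennreal (\<bar>?m - b\<bar> powr p) * indicator A y \<partial>lborel)"
      by (simp add: nn_integral_cmult_indicator)
    also have "\<dots> \<le> (\<integral>\<^sup>+y\<in>B. ennreal (\<bar>u y - b\<bar> powr p) \<partial>lborel)"
      using A p by (intro nn_integral_mono) (auto simp: indicator_def intro!: ennreal_leI powr_mono2)
    finally show ?thesis .
  qed
  obtain A where A: "A \<in> sets borel" "A \<subseteq> B" "\<And>y. y \<in> A \<Longrightarrow> \<bar>?m - b\<bar> \<le> \<bar>u y - b\<bar>"
    and Bm: "emeasure lborel B \<le> 2 * emeasure lborel A"
  proof (cases "b \<le> ?m")
    case True
    show ?thesis by (rule that[of "{y \<in> B. ?m \<le> u y}"]) (use True med in \<open>auto simp: is_median_def\<close>)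
  next
    case False
    show ?thesis by (rule that[of "{y \<in> B. u y \<le> ?m}"]) (use False med in \<open>auto simp: is_median_def\<close>)
  qed
  have "ennreal (\<bar>?m - b\<bar> powr p) * emeasure lborel B
      \<le> ennreal (\<bar>?m - b\<bar> powr p) * (2 * emeasure lborel A)"
    by (rule mult_left_mono[OF Bm]) simp
  also have "\<dots> = 2 * (ennreal (\<bar>?m - b\<bar> powr p) * emeasure lborel A)" by (simp add: ac_simps)
  also have "\<dots> \<le> 2 * (\<integral>\<^sup>+y\<in>B. ennreal (\<bar>u y - b\<bar> powr p) \<partial>lborel)"
    by (rule mult_left_mono[OF half[OF A]]) simp_all
  finally show ?thesis .
qed

section \<open>Telescoping along geometric sequences\<close>

text \<open>Increments measured at the geometric parameters $s, \rho s, \rho^2 s, \dots$ form a geometric series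
  dominated by its first term. In the companion below the largest parameter dominates.\<close>
lemma telescope_up:
  fixes f :: "real \<Rightarrow> real"
  assumes "1 < \<rho>" "0 < \<sigma>" "0 \<le> Q" "0 < s" "s \<le> t"
    and step: "\<And>a b. s \<le> a \<Longrightarrow> a \<le> b \<Longrightarrow> b \<le> t \<Longrightarrow> b \<le> \<rho> * a \<Longrightarrow> \<bar>f a - f b\<bar> \<le> Q * a powr - \<sigma>"
  shows "\<bar>f s - f t\<bar> \<le> Q / (1 - \<rho> powr - \<sigma>) * s powr - \<sigma>"
proof -
  define \<theta> where "\<theta> = \<rho> powr - \<sigma>"
  have th: "0 < \<theta>" "\<theta> < 1"
    unfolding \<theta>_def using assms(1,2) by (simp_all add: powr_minus_divide)
  have th1: "Q \<le> Q / (1 - \<theta>)"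
    using th assms(3) by (simp add: field_simps)
  have main: "\<bar>f a - f t\<bar> \<le> Q / (1 - \<theta>) * a powr - \<sigma>" if "s \<le> a" "a \<le> t" "t \<le> \<rho> ^ k * a" for k a
    using that
  proof (induction k arbitrary: a)
    case 0
    then show ?case using th assms(3) by simp
  next
    case (Suc k)
    show ?case
    proof (cases "t \<le> \<rho> * a")
      case True
      then have "\<bar>f a - f t\<bar> \<le> Q * a powr - \<sigma>" using Suc.prems step[of a t] by simp
      also have "\<dots> \<le> Q / (1 - \<theta>) * a powr - \<sigma>" by (rule mult_right_mono[OF th1]) simp
      finally show ?thesis .
    next
      case False
      have a0: "0 < a" and al: "a \<le> \<rho> * a" using assms Suc.prems(1) by auto
      have "\<bar>f (\<rho> * a) - f t\<bar> \<le> Q / (1 - \<theta>) * (\<rho> * a) powr - \<sigma>"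
        using Suc.prems False al by (intro Suc.IH) (auto simp: ac_simps)
      also have "(\<rho> * a) powr - \<sigma> = \<theta> * a powr - \<sigma>"
        unfolding \<theta>_def using assms(1) a0 by (simp add: powr_mult)
      finally have 1: "\<bar>f (\<rho> * a) - f t\<bar> \<le> Q / (1 - \<theta>) * (\<theta> * a powr - \<sigma>)" .
      have 2: "\<bar>f a - f (\<rho> * a)\<bar> \<le> Q * a powr - \<sigma>"
        using Suc.prems False al by (intro step) auto
      have "Q * a powr - \<sigma> + Q / (1 - \<theta>) * (\<theta> * a powr - \<sigma>) = Q / (1 - \<theta>) * a powr - \<sigma>"
        using th by (simp add: field_simps)
      then show ?thesis using 1 2 by linarith
    qed
  qed
  obtain k where "t / s < \<rho> ^ k" using real_arch_pow[OF assms(1)] by blast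
  then have "t \<le> \<rho> ^ k * s" using assms(4) by (simp add: field_simps)
  from main[OF _ assms(5) this] show ?thesis by (simp add: \<theta>_def)
qed

lemma telescope_down:
  fixes f :: "real \<Rightarrow> real"
  assumes "1 < \<rho>" "0 < \<delta>" "0 \<le> Q" "0 < s" "s \<le> t"
    and step: "\<And>a b. s \<le> a \<Longrightarrow> a \<le> b \<Longrightarrow> b \<le> t \<Longrightarrow> b \<le> \<rho> * a \<Longrightarrow> \<bar>f a - f b\<bar> \<le> Q * a powr \<delta>"
  shows "\<bar>f s - f t\<bar> \<le> Q / (1 - \<rho> powr - \<delta>) * t powr \<delta>"
proof -
  define \<theta> where "\<theta> = \<rho> powr - \<delta>"
  have th: "0 < \<theta>" "\<theta> < 1"
    unfolding \<theta>_def using assms(1,2) by (simp_all add: powr_minus_divide)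
  have th1: "Q \<le> Q / (1 - \<theta>)"
    using th assms(3) by (simp add: field_simps)
  have main: "\<bar>f s - f a\<bar> \<le> Q / (1 - \<theta>) * a powr \<delta>" if "s \<le> a" "a \<le> t" "a \<le> \<rho> ^ k * s" for k a
    using that
  proof (induction k arbitrary: a)
    case 0
    then show ?case using th assms(3) by simp
  next
    case (Suc k)
    have a0: "0 < a" using assms Suc.prems(1) by auto
    show ?case
    proof (cases "a \<le> \<rho> * s")
      case True
      then have "\<bar>f s - f a\<bar> \<le> Q * s powr \<delta>" using Suc.prems step[of s a] by simp
      also have "\<dots> \<le> Q / (1 - \<theta>) * a powr \<delta>"
        using th th1 assms Suc.prems by (intro mult_mono powr_mono2) auto
      finally show ?thesis .
    next
      case False
      define b where "b = a / \<rho>"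
      have b: "s \<le> b" "b \<le> a" "a = \<rho> * b" "0 < b"
        using False assms(1) a0 by (auto simp: b_def field_simps)
      have bp: "b powr \<delta> = \<theta> * a powr \<delta>"
        unfolding b_def \<theta>_def using assms(1) a0 by (simp add: powr_divide powr_minus_divide)
      have "b \<le> t" using b(2) Suc.prems(2) by simp
      moreover have "b \<le> \<rho> ^ k * s" using Suc.prems(3) b(3) assms(1) by simp
      ultimately have "\<bar>f s - f b\<bar> \<le> Q / (1 - \<theta>) * b powr \<delta>"
        using b(1) Suc.IH[of b] by blast
      then have 1: "\<bar>f s - f b\<bar> \<le> Q / (1 - \<theta>) * (\<theta> * a powr \<delta>)" by (simp add: bp)
      have "\<bar>f b - f a\<bar> \<le> Q * b powr \<delta>"
        using Suc.prems b by (intro step) auto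
      also have "\<dots> \<le> Q * a powr \<delta>" using b assms by (intro mult_left_mono powr_mono2) auto
      finally have 2: "\<bar>f b - f a\<bar> \<le> Q * a powr \<delta>" .
      have "Q * a powr \<delta> + Q / (1 - \<theta>) * (\<theta> * a powr \<delta>) = Q / (1 - \<theta>) * a powr \<delta>"
        using th by (simp add: field_simps)
      then show ?thesis using 1 2 by linarith
    qed
  qed
  obtain k where "t / s < \<rho> ^ k" using real_arch_pow[OF assms(1)] by blast
  then have "t \<le> \<rho> ^ k * s" using assms(4) by (simp add: field_simps)
  from main[OF assms(5) _ this] show ?thesis by (simp add: \<theta>_def)
qed

section \<open>Distance to the boundary and localised energies\<close>

text \<open>These two relations express comparisons with the boundary distance without extended reals. The case
  of an empty frontier, where the distance is infinite, has to be split off because the real-valued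
  distance to the empty set is \<open>0\<close>.\<close>
definition near :: "real \<Rightarrow> 'a::metric_space set \<Rightarrow> 'a \<Rightarrow> 'a \<Rightarrow> bool" where
  "near \<tau> D x y \<longleftrightarrow> frontier D = {} \<or> dist x y < \<tau> * infdist x (frontier D)"

definition clearance :: "'a::metric_space set \<Rightarrow> 'a \<Rightarrow> real \<Rightarrow> bool" where
  "clearance D x r \<longleftrightarrow> frontier D = {} \<or> r \<le> infdist x (frontier D)"

lemma near_iff_boundary_dist:
  assumes "0 < \<tau>"
  shows "near \<tau> D x y \<longleftrightarrow> ereal (dist x y) < ereal \<tau> * boundary_dist D x"
  using assms by (simp add: near_def boundary_dist_def)

lemma clearance_iff_boundary_dist: "clearance D x r \<longleftrightarrow> ereal r \<le> boundary_dist D x"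
  by (simp add: clearance_def boundary_dist_def)

lemma clearance_mono: "clearance D x r \<Longrightarrow> s \<le> r \<Longrightarrow> clearance D x s"
  by (auto simp: clearance_def)

lemma clearance_shift: "clearance D x r \<Longrightarrow> clearance D y (r - dist x y)"
  using infdist_triangle[of x "frontier D" y] by (auto simp: clearance_def)

lemma near_if_clearance: "clearance D x r \<Longrightarrow> 0 \<le> \<tau> \<Longrightarrow> dist x y < \<tau> * r \<Longrightarrow> near \<tau> D x y"
  unfolding clearance_def near_def
  using mult_left_mono[of r "infdist x (frontier D)" \<tau>] by fastforce

text \<open>A ball that contained points of \<open>D\<close> and of its complement would meet the frontier, being connected.\<close>
lemma ball_subset_if_clearance:
  fixes D :: "'a::euclidean_space set"
  assumes "x \<in> D" "clearance D x r"
  shows "ball x r \<subseteq> D"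
proof (rule ccontr)
  assume "\<not> ball x r \<subseteq> D"
  then have ne: "ball x r - D \<noteq> {}" by blast
  then have "0 < r" by (metis Diff_empty Diff_eq_empty_iff ball_eq_empty empty_subsetI not_le)
  then have "ball x r \<inter> frontier D \<noteq> {}"
    using connected_Int_frontier[of "ball x r" D] assms(1) ne centre_in_ball[of x r] by blast
  then obtain w where w: "dist x w < r" "w \<in> frontier D" by auto
  then have "infdist x (frontier D) \<le> dist x w" by (simp add: infdist_le)
  then show False using w assms(2) by (auto simp: clearance_def)
qed

lemma near_in_domain:
  fixes D :: "'a::euclidean_space set"
  assumes "open D" "x \<in> D" "near \<tau> D x y" "\<tau> \<le> 1"
  shows "y \<in> D"
proof -
  have "\<exists>r. dist x y < r \<and> clearance D x r"
  proof (cases "frontier D = {}")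
    case True
    then show ?thesis by (intro exI[of _ "dist x y + 1"]) (simp add: clearance_def)
  next
    case False
    have "\<tau> * infdist x (frontier D) \<le> infdist x (frontier D)"
      using mult_right_mono[OF assms(4) infdist_nonneg[of x "frontier D"]] by simp
    then show ?thesis using assms(3) False
      by (intro exI[of _ "infdist x (frontier D)"]) (auto simp: near_def clearance_def)
  qed
  then show ?thesis using ball_subset_if_clearance[OF assms(2)] by fastforce
qed

definition inner_energy ::
    "real \<Rightarrow> real \<Rightarrow> real \<Rightarrow> 'a::euclidean_space set \<Rightarrow> ('a \<Rightarrow> real) \<Rightarrow> 'a \<Rightarrow> ennreal" where
  "inner_energy \<delta> p \<tau> D u x =
     (\<integral>\<^sup>+y\<in>{y. near \<tau> D x y}.
        ennreal (\<bar>u x - u y\<bar> powr p / norm (x - y) powr (real DIM('a) + \<delta> * p)) \<partial>lborel)"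

text \<open>This integral bounds the energy in all balls that a path starting at \<open>x\<close> can visit at parameters
  \<open>s\<close> not much smaller than the boundary distance of \<open>x\<close>: there the boundary distance of \<open>y\<close> is
  comparable to \<open>s\<close>, so that the weight is of order $s^{-n}$. Since the definition mentions no path, it is
  measurable in \<open>x\<close> without any measurable choice of paths. The points \<open>y\<close> of such a
  ball satisfy $|x - y| \le 2s$ and $d(y) \ge s/(2K)$, whence the factor \<open>4 * K\<close>. For an empty
  frontier the weight is
  $1/0 = 0$.\<close>
definition far_energy ::
    "real \<Rightarrow> real \<Rightarrow> real \<Rightarrow> real \<Rightarrow> 'a::euclidean_space set \<Rightarrow> ('a \<Rightarrow> real) \<Rightarrow> 'a \<Rightarrow> ennreal" where
  "far_energy \<delta> p \<tau> K D u x =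
     (\<integral>\<^sup>+y\<in>{y \<in> D. dist x y \<le> 4 * K * infdist y (frontier D)}.
        inner_energy \<delta> p \<tau> D u y * ennreal (1 / infdist y (frontier D) ^ DIM('a)) \<partial>lborel)"

lemma measurable_infdist [measurable]:
  "(\<lambda>x::'a::metric_space. infdist x A) \<in> borel_measurable borel"
  by (intro borel_measurable_continuous_onI continuous_intros)

lemma near_section_measurable [measurable]:
  "Measurable.pred borel (near \<tau> (D::'a::euclidean_space set) x)"
  unfolding near_def by measurable

lemma near_measurable [measurable]:
  "Measurable.pred (borel \<Otimes>\<^sub>M borel) (\<lambda>z. near \<tau> (D::'a::euclidean_space set) (fst z) (snd z))"
  unfolding near_def by measurable

lemma inner_energy_measurable [measurable]:
  fixes u :: "'a::euclidean_space \<Rightarrow> real"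
  assumes [measurable]: "u \<in> borel_measurable borel"
  shows "inner_energy \<delta> p \<tau> D u \<in> borel_measurable borel"
proof -
  have "(\<lambda>x. \<integral>\<^sup>+y. ennreal (\<bar>u x - u y\<bar> powr p / norm (x - y) powr (real DIM('a) + \<delta> * p)) *
      (if near \<tau> D (fst (x, y)) (snd (x, y)) then 1 else 0) \<partial>lborel) \<in> borel_measurable borel"
    by measurable
  then show ?thesis
    unfolding inner_energy_def indicator_def by simp
qed

text \<open>By Tonelli's theorem the energy at \<open>y\<close> is counted with its weight $d(y)^{-n}$ times the measure of
  the ball of radius $4K\,d(y)$ about \<open>y\<close>, and this product is bounded by a constant.\<close>
lemma integral_far_energy:
  fixes u :: "'a::euclidean_space \<Rightarrow> real"
  assumes [measurable]: "u \<in> borel_measurable borel" and D: "open D" and K: "0 \<le> K"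
  shows "(\<integral>\<^sup>+x. far_energy \<delta> p \<tau> K D u x \<partial>lborel)
     \<le> ennreal (unit_ball_vol DIM('a) * (4 * K) ^ DIM('a)) * (\<integral>\<^sup>+y\<in>D. inner_energy \<delta> p \<tau> D u y \<partial>lborel)"
    (is "_ \<le> ?c * _")
    and far_energy_measurable: "far_energy \<delta> p \<tau> K D u \<in> borel_measurable borel"
proof -
  let ?d = "\<lambda>y. infdist y (frontier D)" and ?g = "inner_energy \<delta> p \<tau> D u"
  have [measurable]: "D \<in> sets borel" using D by simp
  define k where "k x y = ?g y * ennreal (1 / ?d y ^ DIM('a)) *
      indicator {z. snd z \<in> D \<and> dist (fst z) (snd z) \<le> 4 * K * ?d (snd z)} (x, y)" for x y
  have k_meas [measurable]: "case_prod k \<in> borel_measurable (lborel \<Otimes>\<^sub>M lborel)"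
    unfolding k_def by measurable
  have far: "far_energy \<delta> p \<tau> K D u x = (\<integral>\<^sup>+y. k x y \<partial>lborel)" for x
    unfolding far_energy_def k_def indicator_def by simp
  have "(\<lambda>x. \<integral>\<^sup>+y. k x y \<partial>lborel) \<in> borel_measurable lborel" by measurable
  then show "far_energy \<delta> p \<tau> K D u \<in> borel_measurable borel"
    unfolding far[abs_def] by simp
  have k_le: "(\<integral>\<^sup>+x. k x y \<partial>lborel) \<le> ?c * (?g y * indicator D y)" for y
  proof (cases "y \<in> D")
    case True
    have "(\<integral>\<^sup>+x. k x y \<partial>lborel)
        = (\<integral>\<^sup>+x. ?g y * ennreal (1 / ?d y ^ DIM('a)) * indicator (cball y (4 * K * ?d y)) x \<partial>lborel)"
      using True by (intro nn_integral_cong) (auto simp: k_def indicator_def dist_commute)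
    also have "\<dots> = ?g y * ennreal (1 / ?d y ^ DIM('a)) * emeasure lborel (cball y (4 * K * ?d y))"
      by (simp add: nn_integral_cmult_indicator)
    also have "\<dots> = ?g y * (ennreal (1 / ?d y ^ DIM('a)) *
        ennreal (unit_ball_vol DIM('a) * (4 * K * ?d y) ^ DIM('a)))"
      using K infdist_nonneg[of y] by (subst emeasure_cball) (auto simp: mult.assoc)
    also have "ennreal (1 / ?d y ^ DIM('a)) * ennreal (unit_ball_vol DIM('a) * (4 * K * ?d y) ^ DIM('a))
        = ennreal (1 / ?d y ^ DIM('a) * (unit_ball_vol DIM('a) * (4 * K * ?d y) ^ DIM('a)))"
      using infdist_nonneg[of y] K by (intro ennreal_mult[symmetric]) auto
    also have "\<dots> \<le> ?c"
      using K by (intro ennreal_leI) (auto simp: power_mult_distrib field_simps)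
    finally show ?thesis using True by (simp add: mult.commute mult_right_mono)
  next
    case False
    then show ?thesis by (simp add: k_def)
  qed
  have "(\<integral>\<^sup>+x. far_energy \<delta> p \<tau> K D u x \<partial>lborel) = (\<integral>\<^sup>+y. (\<integral>\<^sup>+x. k x y \<partial>lborel) \<partial>lborel)"
    unfolding far by (rule lborel_pair.Fubini'[symmetric]) measurable
  also have "\<dots> \<le> (\<integral>\<^sup>+y. ?c * (?g y * indicator D y) \<partial>lborel)"
    by (intro nn_integral_mono k_le)
  also have "\<dots> = ?c * (\<integral>\<^sup>+y\<in>D. ?g y \<partial>lborel)"
    by (rule nn_integral_cmult) measurable
  finally show "(\<integral>\<^sup>+x. far_energy \<delta> p \<tau> K D u x \<partial>lborel) \<le> ?c * (\<integral>\<^sup>+y\<in>D. ?g y \<partial>lborel)" .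
qed

section \<open>Medians along paths\<close>

lemma ennreal_le_divide_const:
  assumes "X * ennreal c \<le> ennreal d * Y" "0 < c" "0 \<le> d"
  shows "X \<le> ennreal (d / c) * Y"
proof -
  have "X * (ennreal c * ennreal (1 / c)) \<le> ennreal d * Y * ennreal (1 / c)"
    using mult_right_mono[OF assms(1), of "ennreal (1 / c)"] by (simp add: mult.assoc)
  moreover have "ennreal c * ennreal (1 / c) = 1"
    using assms(2) by (simp add: ennreal_mult[symmetric])
  moreover have "ennreal d * Y * ennreal (1 / c) = ennreal (d / c) * Y"
    using assms(2,3) ennreal_mult[of d "1 / c"] by (simp add: ac_simps)
  ultimately show ?thesis by simp
qed

lemma le_root_if_ennreal_powr_le:
  assumes "ennreal (\<bar>a\<bar> powr p) \<le> ennreal b" "0 < p" "0 \<le> b"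
  shows "\<bar>a\<bar> \<le> b powr (1 / p)"
proof -
  have "\<bar>a\<bar> powr p \<le> b" using assms(1,3) by (simp add: ennreal_le_iff)
  then have "(\<bar>a\<bar> powr p) powr (1 / p) \<le> b powr (1 / p)"
    using assms(2) by (intro powr_mono2) auto
  then show ?thesis using assms(2) by (simp add: powr_powr)
qed

text \<open>The parameter of a path serves at the same time as the scale of the ball that is placed at the
  corresponding point.\<close>
definition clear_path :: "'a::metric_space set \<Rightarrow> real \<Rightarrow> (real \<Rightarrow> 'a) \<Rightarrow> real \<Rightarrow> real \<Rightarrow> bool" where
  "clear_path D K z a b \<longleftrightarrow>
     (\<forall>s\<in>{a..b}. z s \<in> D \<and> clearance D (z s) (s / K)) \<and>
     (\<forall>s\<in>{a..b}. \<forall>t\<in>{a..b}. dist (z s) (z t) \<le> \<bar>s - t\<bar>)"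

lemma clear_pathD:
  assumes "clear_path D K z a b" "a \<le> s" "s \<le> t" "t \<le> b"
  shows "z s \<in> D" "clearance D (z s) (s / K)" "dist (z s) (z t) \<le> t - s"
proof -
  have "s \<in> {a..b}" "t \<in> {a..b}" using assms by auto
  then show "z s \<in> D" "clearance D (z s) (s / K)" "dist (z s) (z t) \<le> t - s"
    using assms(1,3) unfolding clear_path_def by (blast, blast, fastforce)
qed

lemma clear_path_mono:
  assumes "clear_path D c z a b" "0 < c" "c \<le> K" "0 \<le> a"
  shows "clear_path D K z a b"
proof -
  have "s / K \<le> s / c" if "0 \<le> s" for s using assms that by (simp add: frac_le)
  then show ?thesis
    using assms(1,4) unfolding clear_path_def by (fastforce intro: clearance_mono)
qed

locale frac_params =
  fixes n :: nat and \<tau> \<delta> p K :: real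
  assumes n_pos: "0 < n" and tau: "0 < \<tau>" "\<tau> < 1" and delta_pos: "0 < \<delta>"
    and p_ge_1: "1 \<le> p" and subcritical: "\<delta> * p < real n" and K_ge_1: "1 \<le> K"
begin

text \<open>The ball at parameter \<open>s\<close> has radius $\epsilon s$. The value of $\epsilon$ makes points of balls at
  parameters \<open>s\<close> and \<open>t\<close> with $s \le t \le (1 + \epsilon) s$ near to each other
  (\<open>eps_tau\<close>). The constants below depend on \<open>n\<close>, \<open>\<tau>\<close>, \<open>\<delta>\<close>, \<open>p\<close> and \<open>K\<close> only.\<close>
definition \<epsilon> :: real where "\<epsilon> = \<tau> / (8 * K)"
definition \<sigma> :: real where "\<sigma> = real n / p - \<delta>"

definition step_const :: real where
  "step_const = 4 * 4 powr (real n + \<delta> * p) * \<epsilon> powr (\<delta> * p - real n) / (unit_ball_vol n)\<^sup>2"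
definition up_const :: real where
  "up_const = step_const powr (1 / p) / (1 - (1 + \<epsilon>) powr - \<sigma>)"
definition local_const :: real where
  "local_const = 2 * 2 powr (real n + \<delta> * p) / (unit_ball_vol n * \<epsilon> ^ n)"
definition far_const :: real where
  "far_const = step_const * (2 / \<tau> + 2) ^ n"
definition down_const :: real where
  "down_const = local_const powr (1 / p) + far_const powr (1 / p) / (1 - (1 + \<epsilon>) powr - \<delta>)"

lemma eps_pos: "0 < \<epsilon>" and eps_le: "\<epsilon> \<le> 1 / 8" and eps_tau: "4 * \<epsilon> < \<tau> * (1 / K - \<epsilon>)"
  and eps_K: "\<epsilon> \<le> 1 / (2 * K)"
proof -
  show "0 < \<epsilon>" using tau K_ge_1 by (simp add: \<epsilon>_def)
  show "\<epsilon> \<le> 1 / 8" using tau K_ge_1 by (simp add: \<epsilon>_def field_simps)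
  show "\<epsilon> \<le> 1 / (2 * K)" using tau K_ge_1 by (simp add: \<epsilon>_def field_simps)
  have "\<tau> * \<tau> < 4 * \<tau>" using tau by (intro mult_strict_right_mono) auto
  then show "4 * \<epsilon> < \<tau> * (1 / K - \<epsilon>)" using tau K_ge_1 by (simp add: \<epsilon>_def field_simps)
qed

lemma sigma_pos: "0 < \<sigma>"
  using p_ge_1 subcritical by (simp add: \<sigma>_def field_simps)

lemma const_pos: "0 < step_const" "0 < local_const" "0 < far_const"
proof -
  have v: "0 < unit_ball_vol (real n)" by simp
  show *: "0 < step_const"
    unfolding step_const_def using eps_pos v by (intro divide_pos_pos mult_pos_pos zero_less_power) auto
  show "0 < local_const"
    unfolding local_const_def using eps_pos v by (intro divide_pos_pos mult_pos_pos zero_less_power) auto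
  show "0 < far_const"
    unfolding far_const_def using * tau by (intro mult_pos_pos zero_less_power add_pos_pos) auto
qed

lemma growth_lt_1: "0 < a \<Longrightarrow> (1 + \<epsilon>) powr - a < 1"
  using eps_pos by (simp add: powr_minus_divide)

lemma up_const_pos: "0 < up_const"
  using const_pos growth_lt_1[OF sigma_pos] by (simp add: up_const_def)

lemma down_const_pos: "0 < down_const"
  using const_pos growth_lt_1[OF delta_pos] by (simp add: down_const_def add_pos_nonneg)

end

locale frac_function = frac_params n \<tau> \<delta> p K for n \<tau> \<delta> p K +
  fixes D :: "'a::euclidean_space set" and u :: "'a \<Rightarrow> real" and e :: real
  assumes n_dim: "n = DIM('a)" and open_D: "open D"
    and u_measurable [measurable]: "u \<in> borel_measurable borel"
    and energy: "(\<integral>\<^sup>+x\<in>D. inner_energy \<delta> p \<tau> D u x \<partial>lborel) = ennreal e" and e_nonneg: "0 \<le> e"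
begin

abbreviation g :: "'a \<Rightarrow> ennreal" where "g \<equiv> inner_energy \<delta> p \<tau> D u"
abbreviation h :: "'a \<Rightarrow> ennreal" where "h \<equiv> far_energy \<delta> p \<tau> K D u"
abbreviation m :: "'a \<Rightarrow> real \<Rightarrow> real" where "m z s \<equiv> median u (ball z (\<epsilon> * s))"

lemma emeasure_ball_n: "0 \<le> r \<Longrightarrow> emeasure lborel (ball (z::'a) r) = ennreal (unit_ball_vol n * r ^ n)"
  by (simp add: emeasure_ball n_dim)

text \<open>On points at distance at most \<open>r\<close> the kernel of the energy is at least $r^{-(n + \delta p)}$.\<close>
lemma kernel_integral_le:
  assumes [measurable]: "B \<in> sets borel" and B: "\<And>y. y \<in> B \<Longrightarrow> near \<tau> D x y \<and> dist x y \<le> r"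
  shows "(\<integral>\<^sup>+y\<in>B. ennreal (\<bar>u y - u x\<bar> powr p) \<partial>lborel) \<le> ennreal (r powr (real n + \<delta> * p)) * g x"
proof -
  let ?N = "real n + \<delta> * p"
  have N: "0 < ?N" using delta_pos p_ge_1 n_pos by (simp add: add_pos_nonneg)
  have pt: "ennreal (\<bar>u y - u x\<bar> powr p)
      \<le> ennreal (r powr ?N) * ennreal (\<bar>u x - u y\<bar> powr p / norm (x - y) powr ?N)" if "y \<in> B" for y
  proof (cases "x = y")
    case False
    have d: "0 < norm (x - y)" "norm (x - y) \<le> r" using False B[OF that] by (auto simp: dist_norm)
    have "norm (x - y) powr ?N \<le> r powr ?N" using d N by (intro powr_mono2) auto
    then have "1 \<le> r powr ?N / norm (x - y) powr ?N" using d by (simp add: field_simps)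
    then have "\<bar>u x - u y\<bar> powr p * 1 \<le> \<bar>u x - u y\<bar> powr p * (r powr ?N / norm (x - y) powr ?N)"
      by (intro mult_left_mono) auto
    then show ?thesis
      by (simp add: ennreal_mult[symmetric] abs_minus_commute mult.commute ennreal_leI)
  qed simp
  have "(\<integral>\<^sup>+y\<in>B. ennreal (\<bar>u y - u x\<bar> powr p) \<partial>lborel)
      \<le> (\<integral>\<^sup>+y. ennreal (r powr ?N) * (ennreal (\<bar>u x - u y\<bar> powr p / norm (x - y) powr ?N)
            * indicator {y. near \<tau> D x y} y) \<partial>lborel)"
    using pt B by (intro nn_integral_mono) (auto simp: indicator_def)
  also have "\<dots> = ennreal (r powr ?N) * g x"
    unfolding inner_energy_def n_dim by (rule nn_integral_cmult) measurable
  finally show ?thesis .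
qed

lemma median_value_le:
  assumes [measurable]: "B \<in> sets borel" and "emeasure lborel B < \<infinity>"
    and "\<And>y. y \<in> B \<Longrightarrow> near \<tau> D x y \<and> dist x y \<le> r"
  shows "ennreal (\<bar>median u B - u x\<bar> powr p) * emeasure lborel B
     \<le> 2 * (ennreal (r powr (real n + \<delta> * p)) * g x)"
proof -
  have "ennreal (\<bar>median u B - u x\<bar> powr p) * emeasure lborel B
      \<le> 2 * (\<integral>\<^sup>+y\<in>B. ennreal (\<bar>u y - u x\<bar> powr p) \<partial>lborel)"
    using assms(2) p_ge_1 by (intro median_deviation) auto
  also have "\<dots> \<le> 2 * (ennreal (r powr (real n + \<delta> * p)) * g x)"
    by (intro mult_left_mono kernel_integral_le assms) auto
  finally show ?thesis .
qed

text \<open>The median property on \<open>B\<close>, with the median on \<open>B'\<close> as the real number, reduces the claim to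
  comparing that median with the single values \<open>u x\<close>, which is the previous lemma.\<close>
lemma median_median_le:
  assumes [measurable]: "B \<in> sets borel" "B' \<in> sets borel"
    and fin: "emeasure lborel B < \<infinity>" "emeasure lborel B' < \<infinity>"
    and B: "\<And>x y. x \<in> B \<Longrightarrow> y \<in> B' \<Longrightarrow> near \<tau> D x y \<and> dist x y \<le> r"
  shows "ennreal (\<bar>median u B - median u B'\<bar> powr p) * emeasure lborel B * emeasure lborel B'
     \<le> 4 * ennreal (r powr (real n + \<delta> * p)) * (\<integral>\<^sup>+x\<in>B. g x \<partial>lborel)"
proof -
  let ?c = "ennreal (r powr (real n + \<delta> * p))"
  have "ennreal (\<bar>median u B - median u B'\<bar> powr p) * emeasure lborel B * emeasure lborel B'
      \<le> 2 * (\<integral>\<^sup>+x\<in>B. ennreal (\<bar>u x - median u B'\<bar> powr p) \<partial>lborel) * emeasure lborel B'"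
    using fin p_ge_1 by (intro mult_right_mono median_deviation) auto
  also have "\<dots> = 2 * (\<integral>\<^sup>+x. ennreal (\<bar>u x - median u B'\<bar> powr p) * indicator B x * emeasure lborel B' \<partial>lborel)"
    by (subst nn_integral_multc) (auto simp: mult.assoc)
  also have "\<dots> \<le> 2 * (\<integral>\<^sup>+x. 2 * ?c * (g x * indicator B x) \<partial>lborel)"
  proof (intro mult_left_mono nn_integral_mono)
    fix x
    show "ennreal (\<bar>u x - median u B'\<bar> powr p) * indicator B x * emeasure lborel B'
        \<le> 2 * ?c * (g x * indicator B x)"
    proof (cases "x \<in> B")
      case True
      have "ennreal (\<bar>median u B' - u x\<bar> powr p) * emeasure lborel B' \<le> 2 * (?c * g x)"
        by (rule median_value_le) (use True fin B in auto)
      then show ?thesis using True by (simp add: abs_minus_commute mult.assoc)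
    qed simp
  qed simp
  also have "(\<integral>\<^sup>+x. 2 * ?c * (g x * indicator B x) \<partial>lborel) = 2 * ?c * (\<integral>\<^sup>+x\<in>B. g x \<partial>lborel)"
    by (rule nn_integral_cmult) measurable
  also have "2 * (2 * ?c * (\<integral>\<^sup>+x\<in>B. g x \<partial>lborel)) = 4 * ?c * (\<integral>\<^sup>+x\<in>B. g x \<partial>lborel)"
    by (simp add: mult.assoc[symmetric])
  finally show ?thesis .
qed

text \<open>The basic estimate for one step along a path; the exponent is $(n + \delta p) - 2n$, since the
  measures of both balls are of order $s^n$.\<close>
lemma step_le:
  assumes s: "0 < s" "s \<le> t" "t \<le> (1 + \<epsilon>) * s" and z: "dist z z' \<le> t - s" "clearance D z (s / K)"
  shows "ennreal (\<bar>m z s - m z' t\<bar> powr p)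
     \<le> ennreal (step_const * s powr (\<delta> * p - real n)) * (\<integral>\<^sup>+x\<in>ball z (\<epsilon> * s). g x \<partial>lborel)"
proof -
  let ?N = "real n + \<delta> * p" and ?B = "ball z (\<epsilon> * s)" and ?B' = "ball z' (\<epsilon> * t)"
  let ?v = "unit_ball_vol n * (\<epsilon> * s) ^ n"
  have es: "0 < \<epsilon> * s" "\<epsilon> * s \<le> \<epsilon> * t" using s eps_pos by auto
  have "\<epsilon> * t \<le> \<epsilon> * ((1 + 1 / 8) * s)"
    using s eps_pos eps_le by (intro mult_left_mono order_trans[OF s(3)] mult_right_mono) auto
  then have et: "\<epsilon> * t \<le> 9 / 8 * (\<epsilon> * s)" by simp
  have ts: "t - s \<le> \<epsilon> * s" using s(3) by (simp add: algebra_simps)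
  have v: "0 < ?v" using es by simp
  have close: "near \<tau> D x y \<and> dist x y \<le> 4 * (\<epsilon> * s)" if "x \<in> ?B" "y \<in> ?B'" for x y
  proof
    have xz: "dist z x < \<epsilon> * s" "dist z' y < \<epsilon> * t" using that by auto
    have "dist x y \<le> dist z x + dist z z' + dist z' y"
      using dist_triangle[of x y z] dist_triangle[of z y z'] by (simp add: dist_commute)
    then show d: "dist x y \<le> 4 * (\<epsilon> * s)" using xz z(1) ts et es by linarith
    have "clearance D x (s / K - dist z x)" by (rule clearance_shift[OF z(2)])
    then have "clearance D x (s / K - \<epsilon> * s)" by (rule clearance_mono) (use xz in simp)
    moreover have "4 * (\<epsilon> * s) < \<tau> * (s / K - \<epsilon> * s)"
      using mult_strict_right_mono[OF eps_tau s(1)] by (simp add: algebra_simps)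
    ultimately show "near \<tau> D x y" using d tau by (intro near_if_clearance[of D x]) auto
  qed
  have "ennreal (\<bar>m z s - m z' t\<bar> powr p) * ennreal (?v * ?v)
      \<le> ennreal (\<bar>m z s - m z' t\<bar> powr p) * emeasure lborel ?B * emeasure lborel ?B'"
  proof -
    have "ennreal ?v \<le> emeasure lborel ?B'"
      using es by (subst emeasure_ball_n) (auto intro!: ennreal_leI mult_left_mono power_mono)
    moreover have "emeasure lborel ?B = ennreal ?v" using es by (intro emeasure_ball_n) auto
    moreover have "ennreal (?v * ?v) = ennreal ?v * ennreal ?v" using v by (intro ennreal_mult) auto
    ultimately show ?thesis by (simp only: mult.assoc) (intro mult_left_mono, auto)
  qed
  also have "\<dots> \<le> 4 * ennreal ((4 * (\<epsilon> * s)) powr ?N) * (\<integral>\<^sup>+x\<in>?B. g x \<partial>lborel)"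
    using es close by (intro median_median_le) (auto simp: emeasure_ball_n)
  also have "4 * ennreal ((4 * (\<epsilon> * s)) powr ?N) = ennreal (4 * (4 * (\<epsilon> * s)) powr ?N)"
    by (simp add: ennreal_mult)
  finally have "ennreal (\<bar>m z s - m z' t\<bar> powr p)
      \<le> ennreal (4 * (4 * (\<epsilon> * s)) powr ?N / (?v * ?v)) * (\<integral>\<^sup>+x\<in>?B. g x \<partial>lborel)"
    by (rule ennreal_le_divide_const) (use v in auto)
  also have "4 * (4 * (\<epsilon> * s)) powr ?N / (?v * ?v) = step_const * s powr (\<delta> * p - real n)"
  proof -
    have pw: "(4 * (\<epsilon> * s)) powr ?N = 4 powr ?N * (\<epsilon> * s) powr ?N"
      by (rule powr_mult)
    have quot: "a powr ?N / (a ^ n * a ^ n) = a powr (\<delta> * p - real n)" if "0 < a" for a :: real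
    proof -
      have "a powr (\<delta> * p - real n) = a powr (?N - (real n + real n))" by simp
      also have "\<dots> = a powr ?N / (a ^ n * a ^ n)"
        using that by (simp add: powr_diff powr_add powr_realpow)
      finally show ?thesis by simp
    qed
    have "4 * (4 * (\<epsilon> * s)) powr ?N / (?v * ?v)
        = 4 * 4 powr ?N * ((\<epsilon> * s) powr ?N / ((\<epsilon> * s) ^ n * (\<epsilon> * s) ^ n)) / (unit_ball_vol n)\<^sup>2"
      unfolding pw by (simp add: power2_eq_square ac_simps)
    also have "\<dots> = 4 * 4 powr ?N * ((\<epsilon> * s) powr (\<delta> * p - real n)) / (unit_ball_vol n)\<^sup>2"
      by (simp only: quot[OF es(1)])
    also have "\<dots> = step_const * s powr (\<delta> * p - real n)"
      using eps_pos s by (simp add: step_const_def powr_mult)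
    finally show ?thesis .
  qed
  finally show ?thesis .
qed

lemma ball_in_D:
  assumes "z \<in> D" "clearance D z (s / K)" "0 \<le> s"
  shows "ball z (\<epsilon> * s) \<subseteq> D"
proof -
  have "\<epsilon> * s \<le> s / (2 * K)" using mult_right_mono[OF eps_K assms(3)] by simp
  also have "\<dots> \<le> s / K" using assms(3) K_ge_1 by (simp add: field_simps)
  finally have "ball z (\<epsilon> * s) \<subseteq> ball z (s / K)" by auto
  then show ?thesis using ball_subset_if_clearance[OF assms(1,2)] by blast
qed

text \<open>Each ball carries at most the total energy, so a step at parameter \<open>s\<close> costs $C e^{1/p} s^{-\sigma}$
  with $\sigma > 0$ because of \<open>subcritical\<close>; thus the length of the path does not matter.\<close>
lemma median_path_decay:
  assumes path: "clear_path D K z a b" and a: "0 < a" "a \<le> b"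
  shows "\<bar>m (z a) a - m (z b) b\<bar> \<le> up_const * e powr (1 / p) * a powr - \<sigma>"
proof -
  let ?Q = "(step_const * e) powr (1 / p)"
  have "\<bar>m (z s) s - m (z t) t\<bar> \<le> ?Q * s powr - \<sigma>"
    if "a \<le> s" "s \<le> t" "t \<le> b" "t \<le> (1 + \<epsilon>) * s" for s t
  proof -
    have s: "0 < s" using a that by simp
    have z: "z s \<in> D" "clearance D (z s) (s / K)" "dist (z s) (z t) \<le> t - s"
      using clear_pathD[OF path] that by auto
    have "ennreal (\<bar>m (z s) s - m (z t) t\<bar> powr p)
        \<le> ennreal (step_const * s powr (\<delta> * p - real n)) * (\<integral>\<^sup>+x\<in>ball (z s) (\<epsilon> * s). g x \<partial>lborel)"
      by (rule step_le) (use s that z in auto)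
    also have "(\<integral>\<^sup>+x\<in>ball (z s) (\<epsilon> * s). g x \<partial>lborel) \<le> (\<integral>\<^sup>+x\<in>D. g x \<partial>lborel)"
      using ball_in_D[OF z(1,2)] s by (intro nn_integral_mono) (auto simp: indicator_def)
    also have "(\<integral>\<^sup>+x\<in>D. g x \<partial>lborel) = ennreal e" by (rule energy)
    finally have "ennreal (\<bar>m (z s) s - m (z t) t\<bar> powr p)
        \<le> ennreal (step_const * s powr (\<delta> * p - real n) * e)"
      using const_pos e_nonneg by (simp add: ennreal_mult mult_left_mono)
    then have "\<bar>m (z s) s - m (z t) t\<bar> \<le> (step_const * s powr (\<delta> * p - real n) * e) powr (1 / p)"
      using p_ge_1 const_pos e_nonneg by (intro le_root_if_ennreal_powr_le) auto
    also have "\<dots> = ?Q * s powr ((\<delta> * p - real n) / p)"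
      using const_pos e_nonneg by (simp add: powr_mult powr_powr ac_simps)
    also have "(\<delta> * p - real n) / p = - \<sigma>" using p_ge_1 by (simp add: \<sigma>_def field_simps)
    finally show ?thesis .
  qed
  then have "\<bar>m (z a) a - m (z b) b\<bar> \<le> ?Q / (1 - (1 + \<epsilon>) powr - \<sigma>) * a powr - \<sigma>"
    using eps_pos sigma_pos a by (intro telescope_up[where f = "\<lambda>s. m (z s) s"]) auto
  also have "?Q / (1 - (1 + \<epsilon>) powr - \<sigma>) = up_const * e powr (1 / p)"
    using const_pos e_nonneg by (simp add: up_const_def powr_mult)
  finally show ?thesis .
qed

end

context frac_function
begin

text \<open>At scales small compared with the boundary distance of \<open>x\<close>, the ball consists of points near \<open>x\<close>,
  and $u(x)$ is compared with the median directly, without a passage to Lebesgue points.\<close>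
lemma median_near_value:
  assumes R: "0 < R" "dist x z \<le> R" and x: "clearance D x (2 * R / \<tau>)"
  shows "ennreal (\<bar>m z R - u x\<bar> powr p) \<le> ennreal (local_const * R powr (\<delta> * p)) * g x"
proof -
  let ?N = "real n + \<delta> * p" and ?v = "unit_ball_vol n * (\<epsilon> * R) ^ n"
  have eR: "0 < \<epsilon> * R" "\<epsilon> * R \<le> R" using R eps_pos eps_le by auto
  have v: "0 < ?v" using eR by simp
  have close: "near \<tau> D x y \<and> dist x y \<le> 2 * R" if "y \<in> ball z (\<epsilon> * R)" for y
  proof -
    have "dist x y < 2 * R"
      using that R eR dist_triangle[of x y z] by (simp add: dist_commute)
    then show ?thesis using tau by (auto intro: near_if_clearance[OF x])
  qed
  have "ennreal (\<bar>m z R - u x\<bar> powr p) * ennreal ?v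
      = ennreal (\<bar>m z R - u x\<bar> powr p) * emeasure lborel (ball z (\<epsilon> * R))"
    using eR by (simp add: emeasure_ball_n)
  also have "\<dots> \<le> 2 * (ennreal ((2 * R) powr ?N) * g x)"
    using eR close by (intro median_value_le) (auto simp: emeasure_ball_n)
  also have "\<dots> = ennreal (2 * (2 * R) powr ?N) * g x"
    by (simp add: ennreal_mult mult.assoc)
  finally have "ennreal (\<bar>m z R - u x\<bar> powr p) \<le> ennreal (2 * (2 * R) powr ?N / ?v) * g x"
    by (rule ennreal_le_divide_const) (use v in auto)
  also have "2 * (2 * R) powr ?N / ?v = local_const * R powr (\<delta> * p)"
    using R by (simp add: local_const_def powr_mult powr_add powr_realpow power_mult_distrib)
  finally show ?thesis .
qed

text \<open>At scales not small compared with the boundary distance of \<open>x\<close>, that of each point of the ball lies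
  between $s/(2K)$ and $(2/\tau + 2) s$. The lower bound puts the ball into the domain of integration
  of the far energy, the upper bound controls the weight from below.\<close>
lemma integral_ball_le_far_energy:
  assumes fr: "frontier D \<noteq> {}" and s: "0 < s" and z: "z \<in> D" "clearance D z (s / K)" "dist x z \<le> s"
    and x: "\<tau> * infdist x (frontier D) \<le> 2 * s"
  shows "(\<integral>\<^sup>+y\<in>ball z (\<epsilon> * s). g y \<partial>lborel) \<le> ennreal (((2 / \<tau> + 2) * s) ^ n) * h x"
proof -
  let ?d = "\<lambda>y. infdist y (frontier D)" and ?c = "((2 / \<tau> + 2) * s) ^ n"
  have [measurable]: "D \<in> sets borel" using open_D by simp
  have pt: "g y \<le> ennreal ?c * (g y * ennreal (1 / ?d y ^ n)) \<and> y \<in> D \<and> dist x y \<le> 4 * K * ?d y"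
    if y: "y \<in> ball z (\<epsilon> * s)" for y
  proof -
    have zy: "dist z y < \<epsilon> * s" using y by simp
    have es: "\<epsilon> * s \<le> s / (2 * K)" "\<epsilon> * s \<le> s"
      using mult_right_mono[OF eps_K, of s] eps_le s by auto
    have "s / K - dist z y \<le> ?d y"
      using clearance_shift[OF z(2), of y] fr by (simp add: clearance_def)
    moreover have "s / K = s / (2 * K) + s / (2 * K)" by (simp add: field_simps)
    ultimately have low: "s / (2 * K) \<le> ?d y" using zy es by linarith
    have dxy: "dist x y \<le> 2 * s" using dist_triangle[of x y z] zy z(3) es by linarith
    have "2 * s \<le> 4 * K * ?d y"
      using low K_ge_1 by (simp add: field_simps)
    then have 1: "dist x y \<le> 4 * K * ?d y" using dxy by simp
    have "?d x \<le> 2 / \<tau> * s" using x tau by (simp add: field_simps)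
    then have "?d y \<le> (2 / \<tau> + 2) * s"
      using infdist_triangle[of y "frontier D" x] dxy by (simp add: dist_commute distrib_right)
    moreover have pos: "0 < ?d y" using low s K_ge_1 by (auto intro: less_le_trans[OF _ low])
    ultimately have "?d y ^ n \<le> ?c" by (intro power_mono) auto
    then have "1 \<le> ?c * (1 / ?d y ^ n)" using pos by (simp add: field_simps)
    then have "ennreal 1 * g y \<le> ennreal (?c * (1 / ?d y ^ n)) * g y"
      by (intro mult_right_mono ennreal_leI) auto
    also have "ennreal (?c * (1 / ?d y ^ n)) = ennreal ?c * ennreal (1 / ?d y ^ n)"
      using s tau pos by (intro ennreal_mult) auto
    finally have 2: "g y \<le> ennreal ?c * (g y * ennreal (1 / ?d y ^ n))" by (simp add: ac_simps)
    show ?thesis using 1 2 ball_in_D[OF z(1,2)] s y by auto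
  qed
  have "(\<integral>\<^sup>+y\<in>ball z (\<epsilon> * s). g y \<partial>lborel) \<le> (\<integral>\<^sup>+y. ennreal ?c *
      (g y * ennreal (1 / ?d y ^ n) * indicator {y \<in> D. dist x y \<le> 4 * K * ?d y} y) \<partial>lborel)"
    using pt by (intro nn_integral_mono) (auto simp: indicator_def)
  also have "\<dots> = ennreal ?c * h x"
    unfolding far_energy_def n_dim by (rule nn_integral_cmult) measurable
  finally show ?thesis .
qed

text \<open>The direct comparison is used up to the scale $\tau\,d(x)/2$. From there on the steps are bounded by
  the far energy. The largest scale \<open>R\<close> dominates both contributions.\<close>
lemma value_median_path:
  assumes path: "clear_path D K z 0 T" and x: "z 0 = x" "g x + h x < \<infinity>" and R: "0 < R" "R \<le> T"
  shows "\<bar>u x - m (z R) R\<bar> \<le> down_const * R powr \<delta> * enn2real (g x + h x) powr (1 / p)"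
proof -
  define w where "w = enn2real (g x + h x)"
  have w: "0 \<le> w" "g x + h x = ennreal w" using x(2) by (auto simp: w_def)
  have gw: "g x \<le> ennreal w" and hw: "h x \<le> ennreal w"
    unfolding w(2)[symmetric] by auto
  have path_at: "z s \<in> D" "clearance D (z s) (s / K)" "dist x (z s) \<le> s" if "0 \<le> s" "s \<le> T" for s
    using clear_pathD[OF path, of s s] clear_pathD(3)[OF path, of 0 s] that x(1) by auto
  have loc: "\<bar>u x - m (z r) r\<bar> \<le> local_const powr (1 / p) * r powr \<delta> * w powr (1 / p)"
    if r: "0 < r" "r \<le> T" "clearance D x (2 * r / \<tau>)" for r
  proof -
    have "ennreal (\<bar>m (z r) r - u x\<bar> powr p) \<le> ennreal (local_const * r powr (\<delta> * p)) * g x"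
      using r path_at by (intro median_near_value) auto
    also have "\<dots> \<le> ennreal (local_const * r powr (\<delta> * p)) * ennreal w"
      using gw by (rule mult_left_mono) simp
    finally have "ennreal (\<bar>m (z r) r - u x\<bar> powr p) \<le> ennreal (local_const * r powr (\<delta> * p) * w)"
      using const_pos w by (simp add: ennreal_mult)
    then have "\<bar>m (z r) r - u x\<bar> \<le> (local_const * r powr (\<delta> * p) * w) powr (1 / p)"
      using p_ge_1 const_pos w by (intro le_root_if_ennreal_powr_le) auto
    also have "\<dots> = local_const powr (1 / p) * r powr \<delta> * w powr (1 / p)"
      using const_pos w p_ge_1 by (simp add: powr_mult powr_powr)
    finally show ?thesis by (simp add: abs_minus_commute)
  qed
  let ?F = "far_const powr (1 / p) / (1 - (1 + \<epsilon>) powr - \<delta>)"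
  have F: "0 \<le> ?F" using growth_lt_1[OF delta_pos] by simp
  have split: "down_const * R powr \<delta> * w powr (1 / p)
      = local_const powr (1 / p) * R powr \<delta> * w powr (1 / p) + ?F * R powr \<delta> * w powr (1 / p)"
    by (simp add: down_const_def distrib_right)
  have "\<bar>u x - m (z R) R\<bar> \<le> down_const * R powr \<delta> * w powr (1 / p)"
  proof (cases "clearance D x (2 * R / \<tau>)")
    case True
    have "0 \<le> ?F * R powr \<delta> * w powr (1 / p)" using F by (intro mult_nonneg_nonneg) auto
    then show ?thesis using loc[OF R True] split by linarith
  next
    case False
    let ?d = "infdist x (frontier D)"
    have fr: "frontier D \<noteq> {}" and dR: "?d < 2 * R / \<tau>" using False by (auto simp: clearance_def)
    have "x \<in> D" using path_at[of 0] R x(1) by simp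
    then have "x \<notin> frontier D" using open_D by (simp add: frontier_def interior_open)
    then have d0: "0 < ?d"
      using infdist_pos_not_in_closed[OF frontier_closed fr] by simp
    define r where "r = \<tau> * ?d / 2"
    have r: "0 < r" "r < R" "2 * r / \<tau> = ?d"
      using d0 dR tau by (auto simp: r_def field_simps)
    have 1: "\<bar>u x - m (z r) r\<bar> \<le> local_const powr (1 / p) * r powr \<delta> * w powr (1 / p)"
      using r R by (intro loc) (auto simp: clearance_def)
    also have "\<dots> \<le> local_const powr (1 / p) * R powr \<delta> * w powr (1 / p)"
      using r delta_pos by (intro mult_right_mono mult_left_mono powr_mono2) auto
    finally have A: "\<bar>u x - m (z r) r\<bar> \<le> local_const powr (1 / p) * R powr \<delta> * w powr (1 / p)" .
    let ?Q = "far_const powr (1 / p) * w powr (1 / p)"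
    have "\<bar>m (z s) s - m (z t) t\<bar> \<le> ?Q * s powr \<delta>"
      if st: "r \<le> s" "s \<le> t" "t \<le> R" "t \<le> (1 + \<epsilon>) * s" for s t
    proof -
      have s: "0 < s" "s \<le> T" "t \<le> T" using r st R by auto
      have "\<tau> * ?d \<le> 2 * s" using st(1) by (simp add: r_def)
      then have ball: "(\<integral>\<^sup>+y\<in>ball (z s) (\<epsilon> * s). g y \<partial>lborel) \<le> ennreal (((2 / \<tau> + 2) * s) ^ n) * h x"
        using fr s path_at by (intro integral_ball_le_far_energy) auto
      have "ennreal (\<bar>m (z s) s - m (z t) t\<bar> powr p)
          \<le> ennreal (step_const * s powr (\<delta> * p - real n)) * (\<integral>\<^sup>+y\<in>ball (z s) (\<epsilon> * s). g y \<partial>lborel)"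
        using s st path_at clear_pathD(3)[OF path, of s t] by (intro step_le) auto
      also have "\<dots> \<le> ennreal (step_const * s powr (\<delta> * p - real n)) * (ennreal (((2 / \<tau> + 2) * s) ^ n) * ennreal w)"
        by (intro mult_left_mono order_trans[OF ball] hw) auto
      also have "\<dots> = ennreal (step_const * s powr (\<delta> * p - real n) * ((2 / \<tau> + 2) * s) ^ n * w)"
        using const_pos s tau w by (simp add: ennreal_mult mult.assoc)
      also have "step_const * s powr (\<delta> * p - real n) * ((2 / \<tau> + 2) * s) ^ n = far_const * s powr (\<delta> * p)"
        using s by (simp add: far_const_def power_mult_distrib powr_diff powr_realpow)
      finally have "\<bar>m (z s) s - m (z t) t\<bar> \<le> (far_const * s powr (\<delta> * p) * w) powr (1 / p)"
        using p_ge_1 const_pos w by (intro le_root_if_ennreal_powr_le) auto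
      also have "\<dots> = ?Q * s powr \<delta>"
        using const_pos w p_ge_1 by (simp add: powr_mult powr_powr)
      finally show ?thesis .
    qed
    then have "\<bar>m (z r) r - m (z R) R\<bar> \<le> ?Q / (1 - (1 + \<epsilon>) powr - \<delta>) * R powr \<delta>"
      using eps_pos delta_pos r by (intro telescope_down[where f = "\<lambda>s. m (z s) s"]) auto
    also have "\<dots> = ?F * R powr \<delta> * w powr (1 / p)" by simp
    finally show ?thesis using A split by linarith
  qed
  then show ?thesis by (simp add: w_def)
qed

lemma median_join:
  assumes "clear_path D K z1 T S" "clear_path D K z2 T S" "z1 S = z2 S" "0 < T" "T \<le> S"
  shows "\<bar>m (z1 T) T - m (z2 T) T\<bar> \<le> 2 * (up_const * e powr (1 / p) * T powr - \<sigma>)"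
  using median_path_decay[OF assms(1,4,5)] median_path_decay[OF assms(2,4,5)] assms(3) by simp

end

section \<open>Paths in unbounded John domains\<close>

text \<open>A partition for the arc from \<open>0\<close> to \<open>s\<close>, extended by the points \<open>s\<close> and \<open>t\<close>, is a partition for
  the arc from \<open>0\<close> to \<open>t\<close>; so the arc up to \<open>t\<close> is longer by at least the chord.\<close>
lemma arc_length_param_lipschitz:
  fixes \<gamma> :: "real \<Rightarrow> 'a::metric_space"
  assumes "arc_length_param \<gamma> l" "s \<in> {0..l}" "t \<in> {0..l}"
  shows "dist (\<gamma> s) (\<gamma> t) \<le> \<bar>s - t\<bar>"
proof -
  have *: "dist (\<gamma> s) (\<gamma> t) \<le> t - s" if st: "0 \<le> s" "s \<le> t" "t \<le> l" for s t
  proof -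
    let ?P = "\<lambda>b. {(k::nat, r::nat \<Rightarrow> real). mono_on {..k} r \<and> r ` {..k} \<subseteq> {0..b}}"
    let ?L = "\<lambda>(k, r). \<Sum>i<k. ennreal (dist (\<gamma> (r i)) (\<gamma> (r (Suc i))))"
    have ext: "?L kr + ennreal (dist (\<gamma> s) (\<gamma> t)) \<le> curve_length \<gamma> 0 t" if kr_in: "kr \<in> ?P s" for kr
    proof -
      obtain k r where kr: "kr = (k, r)" "mono_on {..k} r" "r ` {..k} \<subseteq> {0..s}"
        using kr_in by auto
      define r' where "r' i = (if i \<le> k then r i else if i = Suc k then s else t)" for i
      have rs: "0 \<le> r i" "r i \<le> s" if "i \<le> k" for i using kr(3) that by auto
      have "mono_on {..Suc (Suc k)} r'"
        unfolding mono_on_def r'_def using rs st monotone_onD[OF kr(2)]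
        by (auto intro: order_trans)
      moreover have "r' ` {..Suc (Suc k)} \<subseteq> {0..t}"
        using rs(1) order_trans[OF rs(2) st(2)] st by (auto simp: r'_def)
      ultimately have "(Suc (Suc k), r') \<in> ?P t" by simp
      then have *: "?L (Suc (Suc k), r') \<le> curve_length \<gamma> 0 t"
        unfolding curve_length_def by (rule SUP_upper)
      have **: "?L (Suc (Suc k), r') = ?L kr + ennreal (dist (\<gamma> (r k)) (\<gamma> s)) + ennreal (dist (\<gamma> s) (\<gamma> t))"
        by (simp add: kr(1) r'_def sum_nonneg)
      have "?L kr + ennreal (dist (\<gamma> s) (\<gamma> t)) \<le> ?L (Suc (Suc k), r')"
        unfolding ** by (intro add_right_mono) simp
      then show ?thesis using * by (rule order_trans)
    qed
    have ne: "?P s \<noteq> {}"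
    proof -
      have "(0, \<lambda>_. 0) \<in> ?P s" using st by (auto simp: mono_on_def)
      then show ?thesis by blast
    qed
    have "curve_length \<gamma> 0 s + ennreal (dist (\<gamma> s) (\<gamma> t)) = (SUP kr\<in>?P s. ?L kr + ennreal (dist (\<gamma> s) (\<gamma> t)))"
      unfolding curve_length_def using ne by (subst ennreal_SUP_add_left) (auto simp: case_prod_unfold)
    also have "\<dots> \<le> curve_length \<gamma> 0 t" by (rule SUP_least) (rule ext)
    finally have "ennreal s + ennreal (dist (\<gamma> s) (\<gamma> t)) \<le> ennreal t"
      using assms(1) st unfolding arc_length_param_def by simp
    then show ?thesis using st by (simp add: ennreal_plus[symmetric] del: ennreal_plus)
  qed
  show ?thesis
    using *[of s t] *[of t s] assms(2,3) by (cases "s \<le> t") (auto simp: dist_commute)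
qed

text \<open>On the first half of a John curve the minimum in the John condition is the arc length from the
  starting point, and this half is long if the other end is far away.\<close>
lemma john_escape:
  fixes D :: "'a::euclidean_space set"
  assumes D: "john_domain c D" "\<not> bounded D" and x: "x \<in> D" and T: "0 < T"
  shows "\<exists>z. z 0 = x \<and> clear_path D c z 0 T"
proof -
  have "\<exists>y\<in>D. 2 * T < dist x y"
    using D(2) unfolding bounded_def by (meson not_le)
  then obtain y where y: "y \<in> D" "2 * T < dist x y" by blast
  obtain \<gamma> l where \<gamma>: "arc_length_param \<gamma> l" "\<gamma> ` {0..l} \<subseteq> D" "\<gamma> 0 = x" "\<gamma> l = y"
    and cl: "\<And>t. t \<in> {0..l} \<Longrightarrow> ereal (min t (l - t) / c) \<le> boundary_dist D (\<gamma> t)"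
    using D(1) x y(1) unfolding john_domain_def by metis
  have l0: "0 \<le> l" using \<gamma>(1) by (simp add: arc_length_param_def)
  have "dist x y \<le> \<bar>0 - l\<bar>"
    using arc_length_param_lipschitz[OF \<gamma>(1), of 0 l] \<gamma>(3,4) l0 by simp
  then have l: "2 * T \<le> l" using y l0 by simp
  have "clearance D (\<gamma> s) (s / c)" if "0 \<le> s" "s \<le> T" for s
  proof -
    have "min s (l - s) = s" using that l by simp
    then show ?thesis using cl[of s] that l by (simp add: clearance_iff_boundary_dist)
  qed
  then have "clear_path D c \<gamma> 0 T"
    using \<gamma>(2) l T arc_length_param_lipschitz[OF \<gamma>(1)] unfolding clear_path_def by auto
  then show ?thesis using \<gamma>(3) by blast
qed

text \<open>If the curve starts at a point with clearance $T/c$, its parameter may be shifted by \<open>T\<close>: while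
  $t < T/(2c)$, the clearance of the starting point suffices, and afterwards $t/c$ is at least
  $(T + t)/(3c^2)$.\<close>
lemma clear_path_half_curve:
  fixes \<gamma> :: "real \<Rightarrow> 'a::metric_space"
  assumes c: "1 \<le> c" and T: "0 < T" and cl0: "clearance D (\<gamma> 0) (T / c)"
    and cl: "\<And>t. t \<in> {0..L} \<Longrightarrow> clearance D (\<gamma> t) (t / c)"
    and inD: "\<And>t. t \<in> {0..L} \<Longrightarrow> \<gamma> t \<in> D"
    and lip: "\<And>s t. s \<in> {0..L} \<Longrightarrow> t \<in> {0..L} \<Longrightarrow> dist (\<gamma> s) (\<gamma> t) \<le> \<bar>s - t\<bar>"
  shows "clear_path D (3 * c\<^sup>2) (\<lambda>s. \<gamma> (s - T)) T (T + L)"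
proof -
  have "clearance D (\<gamma> t) ((T + t) / (3 * c\<^sup>2))" if t: "0 \<le> t" "t \<le> L" for t
  proof (cases "T \<le> 2 * c * t")
    case True
    have "t \<le> c * t" using c t by (simp add: mult_le_cancel_right1)
    then have "T + t \<le> 3 * c * t" using True by linarith
    then have "(T + t) / (3 * c\<^sup>2) \<le> (3 * c * t) / (3 * c\<^sup>2)" by (rule divide_right_mono) simp
    also have "\<dots> = t / c" using c by (simp add: power2_eq_square)
    finally show ?thesis using cl[of t] t by (auto intro: clearance_mono)
  next
    case False
    have "clearance D (\<gamma> t) (T / c - dist (\<gamma> 0) (\<gamma> t))" by (rule clearance_shift[OF cl0])
    then have 1: "clearance D (\<gamma> t) (T / c - t)"
      by (rule clearance_mono) (use lip[of 0 t] t in simp)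
    have "t \<le> c * t" using c t by (simp add: mult_le_cancel_right1)
    then have "T + t \<le> 3 / 2 * T" using False by linarith
    then have "(T + t) / (3 * c\<^sup>2) \<le> (3 / 2 * T) / (3 * c\<^sup>2)" by (rule divide_right_mono) simp
    also have "\<dots> = T / (2 * c) / c" using c by (simp add: power2_eq_square)
    also have "\<dots> \<le> T / (2 * c) / 1" using c T by (intro divide_left_mono) auto
    also have "\<dots> \<le> T / c - t"
    proof -
      have "t \<le> T / (2 * c)" using False c by (simp add: field_simps)
      moreover have "T / c = T / (2 * c) + T / (2 * c)" by simp
      ultimately show ?thesis by linarith
    qed
    finally show ?thesis using 1 by (auto intro: clearance_mono)
  qed
  note cl' = this
  have "clearance D (\<gamma> (s - T)) (s / (3 * c\<^sup>2))" if "s \<in> {T..T + L}" for s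
    using cl'[of "s - T"] that by simp
  moreover have "dist (\<gamma> (s - T)) (\<gamma> (t - T)) \<le> \<bar>s - t\<bar>" if "s \<in> {T..T + L}" "t \<in> {T..T + L}" for s t
    using lip[of "s - T" "t - T"] that by simp
  moreover have "\<gamma> (s - T) \<in> D" if "s \<in> {T..T + L}" for s
    using inD[of "s - T"] that by simp
  ultimately show ?thesis unfolding clear_path_def by simp
qed

text \<open>The two halves of a John curve from \<open>x\<close> to \<open>y\<close>, each run from its end to the midpoint.\<close>
lemma john_join:
  fixes D :: "'a::euclidean_space set"
  assumes D: "john_domain c D" and T: "0 < T"
    and x: "x \<in> D" "clearance D x (T / c)" and y: "y \<in> D" "clearance D y (T / c)"
  shows "\<exists>z1 z2 S. T \<le> S \<and> clear_path D (3 * c\<^sup>2) z1 T S \<and> clear_path D (3 * c\<^sup>2) z2 T S \<and>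
           z1 T = x \<and> z2 T = y \<and> z1 S = z2 S"
proof -
  have c: "1 \<le> c" using D by (simp add: john_domain_def)
  obtain \<gamma> l where \<gamma>: "arc_length_param \<gamma> l" "\<gamma> ` {0..l} \<subseteq> D" "\<gamma> 0 = x" "\<gamma> l = y"
    and cl: "\<And>t. t \<in> {0..l} \<Longrightarrow> ereal (min t (l - t) / c) \<le> boundary_dist D (\<gamma> t)"
    using D x(1) y(1) unfolding john_domain_def by metis
  have l0: "0 \<le> l" using \<gamma>(1) by (simp add: arc_length_param_def)
  note lip = arc_length_param_lipschitz[OF \<gamma>(1)]
  have cl1: "clearance D (\<gamma> t) (t / c)" if "t \<in> {0..l / 2}" for t
  proof -
    have "min t (l - t) = t" using that by simp
    then show ?thesis using cl[of t] that by (simp add: clearance_iff_boundary_dist)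
  qed
  have cl2: "clearance D (\<gamma> (l - t)) (t / c)" if "t \<in> {0..l / 2}" for t
  proof -
    have "min (l - t) t = t" using that by simp
    then show ?thesis using cl[of "l - t"] that by (simp add: clearance_iff_boundary_dist)
  qed
  have "clear_path D (3 * c\<^sup>2) (\<lambda>s. \<gamma> (s - T)) T (T + l / 2)"
    using c T cl1 \<gamma>(2,3) x(2) lip by (intro clear_path_half_curve) auto
  moreover have "clear_path D (3 * c\<^sup>2) (\<lambda>s. \<gamma> (l - (s - T))) T (T + l / 2)"
  proof (rule clear_path_half_curve[where \<gamma> = "\<lambda>t. \<gamma> (l - t)"])
    show "dist (\<gamma> (l - s)) (\<gamma> (l - t)) \<le> \<bar>s - t\<bar>" if "s \<in> {0..l / 2}" "t \<in> {0..l / 2}" for s t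
      using lip[of "l - s" "l - t"] that by auto
  qed (use c T cl2 \<gamma>(2,4) y(2) in auto)
  ultimately show ?thesis
    using l0 \<gamma>(3,4)
    by (intro exI[of _ "\<lambda>s. \<gamma> (s - T)"] exI[of _ "\<lambda>s. \<gamma> (l - (s - T))"] exI[of _ "T + l / 2"]) simp
qed

section \<open>The Sobolev-Poincare inequality\<close>

text \<open>The two terms balance at $R = (e/w)^{1/n}$. If \<open>e\<close> or \<open>w\<close> vanishes, only one term is left, and \<open>R\<close>
  can be chosen so that it is less than any positive \<open>t\<close>.\<close>
lemma powr_optimisation:
  fixes t A B w e \<delta> p \<sigma> n :: real
  assumes bound: "\<And>R. 0 < R \<Longrightarrow> t \<le> A * R powr \<delta> * w powr (1 / p) + B * e powr (1 / p) * R powr - \<sigma>"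
    and pos: "0 \<le> A" "0 \<le> B" "0 \<le> w" "0 \<le> e" "0 < \<delta>" "0 < p" "0 < n" and \<sigma>: "\<sigma> = n / p - \<delta>" "0 < \<sigma>"
  shows "t \<le> (A + B) * e powr (\<delta> / n) * w powr (1 / p - \<delta> / n)"
proof (cases "t \<le> 0")
  case True
  have "0 \<le> (A + B) * e powr (\<delta> / n) * w powr (1 / p - \<delta> / n)" using pos by simp
  then show ?thesis using True by linarith
next
  case False
  then have t: "0 < t" by simp
  have small: "\<exists>q>0. c * q < t" if "0 \<le> c" for c
    using that t by (intro exI[of _ "t / (2 * (c + 1))"]) (simp add: field_simps add_strict_increasing2)
  consider "e = 0" | "w = 0" | "0 < e" "0 < w" using pos by linarith
  then show ?thesis
  proof cases
    case 1
    obtain q where q: "0 < q" "A * w powr (1 / p) * q < t" using small[of "A * w powr (1 / p)"] pos by auto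
    have "t \<le> A * w powr (1 / p) * q"
      using bound[of "q powr (1 / \<delta>)"] q(1) 1 pos by (simp add: powr_powr ac_simps)
    then show ?thesis using q by linarith
  next
    case 2
    obtain q where q: "0 < q" "B * e powr (1 / p) * q < t" using small[of "B * e powr (1 / p)"] pos by auto
    have "t \<le> B * e powr (1 / p) * q"
      using bound[of "q powr (- 1 / \<sigma>)"] q(1) 2 \<sigma>(2) by (simp add: powr_powr ac_simps)
    then show ?thesis using q by linarith
  next
    case 3
    define R where "R = (e / w) powr (1 / n)"
    have R: "0 < R" using 3 by (simp add: R_def)
    have "R powr \<delta> * w powr (1 / p) = e powr (\<delta> / n) * w powr (1 / p - \<delta> / n)"
      using 3 by (simp add: R_def powr_powr powr_divide powr_diff)
    moreover have "e powr (1 / p) * R powr - \<sigma> = e powr (\<delta> / n) * w powr (1 / p - \<delta> / n)"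
    proof -
      have "- \<sigma> / n = \<delta> / n - 1 / p" using pos \<sigma>(1) by (simp add: field_simps)
      then have "R powr - \<sigma> = (e / w) powr (\<delta> / n - 1 / p)" by (simp add: R_def powr_powr)
      then show ?thesis using 3 by (simp add: powr_divide powr_diff)
    qed
    ultimately show ?thesis
      using bound[OF R] by (simp add: mult.assoc distrib_right)
  qed
qed

context frac_params
begin

definition sob_const :: real where
  "sob_const = (down_const + 3 * up_const) powr (real n * p / (real n - \<delta> * p))
     * (1 + unit_ball_vol n * (4 * K) ^ n)"

lemma sob_const_pos: "0 < sob_const"
proof -
  have "0 < down_const + 3 * up_const" using down_const_pos up_const_pos by simp
  moreover have "0 \<le> unit_ball_vol n * (4 * K) ^ n" using K_ge_1 by simp
  ultimately show ?thesis unfolding sob_const_def by (intro mult_pos_pos) auto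
qed

end

context frac_function
begin

text \<open>The number \<open>a\<close> is a limit point of medians at the parameters \<open>k + 1\<close> of paths that start at
  a fixed point of \<open>D\<close>. All these medians satisfy the bound of the lemma with $R = 1$ at one and the same
  point \<open>x\<close> of finite $g + h$, so they are bounded and have a convergent subsequence. Of the factor \<open>3\<close>,
  one part comes from the path that starts at \<open>x\<close> and two from joining it with the fixed path.\<close>
lemma pointwise_bound:
  assumes D: "john_domain c D" "\<not> bounded D" and K: "K = 3 * c\<^sup>2"
  shows "\<exists>a. \<forall>x\<in>D. g x + h x < \<infinity> \<longrightarrow> (\<forall>R>0. \<bar>u x - a\<bar> \<le>
     down_const * R powr \<delta> * enn2real (g x + h x) powr (1 / p)
     + 3 * up_const * e powr (1 / p) * R powr - \<sigma>)"
proof -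
  have c: "1 \<le> c" using D by (simp add: john_domain_def)
  have "c * 1 \<le> c * (3 * c)" using c by (intro mult_left_mono) auto
  then have cK: "c \<le> K" by (simp add: K power2_eq_square)
  obtain o' where o': "o' \<in> D" using D by (auto simp: john_domain_def)
  have "\<forall>k. \<exists>z. z 0 = o' \<and> clear_path D c z 0 (real (Suc k))"
    using john_escape[OF D o'] by simp
  then obtain \<zeta> where \<zeta>: "\<And>k. clear_path D c (\<zeta> k) 0 (real (Suc k))" by metis
  \<comment> \<open>The parameters start at \<open>1\<close>, since a ball of scale \<open>0\<close> is empty.\<close>
  define a where "a k = m (\<zeta> k (real (Suc k))) (real (Suc k))" for k
  let ?M = "up_const * e powr (1 / p)"
  have M: "0 \<le> ?M" using up_const_pos by simp
  let ?b = "\<lambda>x R. down_const * R powr \<delta> * enn2real (g x + h x) powr (1 / p) + 3 * up_const * e powr (1 / p) * R powr - \<sigma>"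
  have main: "\<bar>u x - a k\<bar> \<le> ?b x R"
    if x: "x \<in> D" "g x + h x < \<infinity>" and R: "0 < R" "R \<le> real (Suc k)" for x R k
  proof -
    let ?T = "real (Suc k)"
    obtain z where z: "z 0 = x" "clear_path D c z 0 ?T" using john_escape[OF D x(1), of ?T] by auto
    have zK: "clear_path D K z 0 ?T" by (rule clear_path_mono[OF z(2)]) (use c cK in auto)
    have zRT: "clear_path D K z R ?T" using zK R unfolding clear_path_def by auto
    have "clearance D (z ?T) (?T / c)" "z ?T \<in> D" "clearance D (\<zeta> k ?T) (?T / c)" "\<zeta> k ?T \<in> D"
      using clear_pathD[OF z(2), of ?T ?T] clear_pathD[OF \<zeta>[of k], of ?T ?T] by auto
    then obtain z1 z2 S where "?T \<le> S" "clear_path D K z1 ?T S" "clear_path D K z2 ?T S"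
      "z1 ?T = z ?T" "z2 ?T = \<zeta> k ?T" "z1 S = z2 S"
      using john_join[OF D(1), of ?T "z ?T" "\<zeta> k ?T"] unfolding K by auto
    then have 1: "\<bar>m (z ?T) ?T - a k\<bar> \<le> 2 * (?M * ?T powr - \<sigma>)"
      using median_join[of z1 ?T S z2] by (simp add: a_def)
    have "?M * ?T powr - \<sigma> \<le> ?M * R powr - \<sigma>"
      using R sigma_pos by (intro mult_left_mono M powr_mono2') auto
    moreover have "\<bar>m (z R) R - m (z ?T) ?T\<bar> \<le> ?M * R powr - \<sigma>"
      by (rule median_path_decay[OF zRT R])
    moreover have "\<bar>u x - m (z R) R\<bar> \<le> down_const * R powr \<delta> * enn2real (g x + h x) powr (1 / p)"
      by (rule value_median_path[OF zK z(1) x(2) R])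
    ultimately have "\<bar>u x - a k\<bar> \<le> down_const * R powr \<delta> * enn2real (g x + h x) powr (1 / p) + 3 * (?M * R powr - \<sigma>)"
      using 1 by linarith
    then show ?thesis by (simp add: mult.assoc)
  qed
  show ?thesis
  proof (cases "\<exists>x\<in>D. g x + h x < \<infinity>")
    case False
    then show ?thesis by blast
  next
    case True
    then obtain x where x: "x \<in> D" "g x + h x < \<infinity>" by blast
    have "bounded (range a)"
    proof (rule boundedI)
      fix y assume "y \<in> range a"
      then obtain k where k: "y = a k" by blast
      show "norm y \<le> \<bar>u x\<bar> + ?b x 1" using main[OF x, of 1 k] unfolding k real_norm_def by linarith
    qed
    then obtain b r where r: "strict_mono (r :: nat \<Rightarrow> nat)" "(a \<circ> r) \<longlonglongrightarrow> b"
      using bounded_imp_convergent_subsequence by blast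
    have "\<bar>u x - b\<bar> \<le> ?b x R" if x: "x \<in> D" "g x + h x < \<infinity>" and R: "0 < R" for x R
    proof -
      have "(\<lambda>k. \<bar>u x - (a \<circ> r) k\<bar>) \<longlonglongrightarrow> \<bar>u x - b\<bar>" by (intro tendsto_intros r)
      moreover obtain j where j: "R \<le> real j" using real_arch_simple by blast
      have "\<bar>u x - (a \<circ> r) k\<bar> \<le> ?b x R" if "j \<le> k" for k
      proof -
        have "j \<le> r k" using that seq_suble[OF r(1), of k] by simp
        then have "R \<le> real (Suc (r k))" using j by simp
        then show ?thesis using main[OF x R] by simp
      qed
      ultimately show ?thesis by (intro LIMSEQ_le_const2) auto
    qed
    then show ?thesis by blast
  qed
qed

text \<open>With the best \<open>R\<close>, the \<open>q\<close>-th power of the pointwise bound is linear in $g + h$, since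
  $(1/p - \delta/n)\,q = 1$.\<close>
lemma sobolev_poincare:
  assumes D: "john_domain c D" "\<not> bounded D" and K: "K = 3 * c\<^sup>2"
  defines "q \<equiv> real n * p / (real n - \<delta> * p)"
  shows "\<exists>a. (\<integral>\<^sup>+x\<in>D. ennreal (\<bar>u x - a\<bar> powr q) \<partial>lborel) \<le> ennreal (sob_const * (e powr (1 / p)) powr q)"
proof -
  have [measurable]: "D \<in> sets borel" using open_D by simp
  have K0: "0 \<le> K" using K_ge_1 by simp
  have [measurable]: "h \<in> borel_measurable borel"
    by (rule far_energy_measurable[OF u_measurable open_D K0])
  obtain a where a: "\<And>x R. x \<in> D \<Longrightarrow> g x + h x < \<infinity> \<Longrightarrow> 0 < R \<Longrightarrow> \<bar>u x - a\<bar> \<le>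
     down_const * R powr \<delta> * enn2real (g x + h x) powr (1 / p)
     + 3 * up_const * e powr (1 / p) * R powr - \<sigma>"
    using pointwise_bound[OF D K] by blast
  let ?C = "down_const + 3 * up_const" and ?v = "unit_ball_vol n * (4 * K) ^ n"
  have C: "0 < ?C" using down_const_pos up_const_pos by simp
  have np: "0 < real n - \<delta> * p" using subcritical by simp
  have q0: "0 < q" unfolding q_def using np n_pos p_ge_1 by simp
  have v: "0 \<le> ?v" using K_ge_1 by simp
  define E where "E = ?C powr q * e powr (\<delta> / real n * q)"
  have pt: "ennreal (\<bar>u x - a\<bar> powr q) \<le> ennreal E * (g x + h x)" if x: "x \<in> D" "g x + h x < \<infinity>" for x
  proof -
    define w where "w = enn2real (g x + h x)"
    have w: "0 \<le> w" "g x + h x = ennreal w" using x(2) by (auto simp: w_def)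
    have "\<bar>u x - a\<bar> \<le> ?C * e powr (\<delta> / real n) * w powr (1 / p - \<delta> / real n)"
    proof (rule powr_optimisation[where \<sigma> = \<sigma>])
      show "\<bar>u x - a\<bar> \<le> down_const * R powr \<delta> * w powr (1 / p) + 3 * up_const * e powr (1 / p) * R powr - \<sigma>"
        if "0 < R" for R using a[OF x that] by (simp add: w_def)
    qed (use down_const_pos up_const_pos w e_nonneg delta_pos p_ge_1 n_pos sigma_pos in \<open>auto simp: \<sigma>_def\<close>)
    then have "\<bar>u x - a\<bar> powr q \<le> (?C * e powr (\<delta> / real n) * w powr (1 / p - \<delta> / real n)) powr q"
      using q0 by (intro powr_mono2) auto
    also have "\<dots> = E * w powr ((1 / p - \<delta> / real n) * q)"
      using C by (simp add: E_def powr_mult powr_powr)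
    also have "(1 / p - \<delta> / real n) * q = 1"
      using np n_pos p_ge_1 by (simp add: q_def field_simps)
    finally have "\<bar>u x - a\<bar> powr q \<le> E * w" using w by simp
    then show ?thesis unfolding w(2) using w by (simp add: E_def ennreal_mult[symmetric] ennreal_leI)
  qed
  have int: "(\<integral>\<^sup>+x\<in>D. (g x + h x) \<partial>lborel) \<le> ennreal ((1 + ?v) * e)"
  proof -
    have "(\<integral>\<^sup>+x\<in>D. (g x + h x) \<partial>lborel) = ennreal e + (\<integral>\<^sup>+x\<in>D. h x \<partial>lborel)"
      by (simp add: distrib_right nn_integral_add energy)
    also have "(\<integral>\<^sup>+x\<in>D. h x \<partial>lborel) \<le> (\<integral>\<^sup>+x. h x \<partial>lborel)"
      by (intro nn_integral_mono) (auto simp: indicator_def)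
    also have "\<dots> \<le> ennreal ?v * ennreal e"
      using integral_far_energy[OF u_measurable open_D K0, of \<delta> p \<tau>] by (simp add: energy n_dim)
    also have "ennreal e + ennreal ?v * ennreal e = ennreal ((1 + ?v) * e)"
      using v e_nonneg by (simp add: ennreal_mult[symmetric] distrib_right)
    finally show ?thesis by (simp add: add_left_mono)
  qed
  have "AE x in lborel. (g x + h x) * indicator D x \<noteq> \<infinity>"
    by (rule nn_integral_PInf_AE) (use int in \<open>auto simp: top_unique\<close>)
  then have "(\<integral>\<^sup>+x\<in>D. ennreal (\<bar>u x - a\<bar> powr q) \<partial>lborel) \<le> (\<integral>\<^sup>+x. ennreal E * ((g x + h x) * indicator D x) \<partial>lborel)"
    by (intro nn_integral_mono_AE, eventually_elim) (use pt in \<open>force simp: indicator_def less_top\<close>)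
  also have "\<dots> = ennreal E * (\<integral>\<^sup>+x\<in>D. (g x + h x) \<partial>lborel)"
    by (rule nn_integral_cmult) measurable
  also have "\<dots> \<le> ennreal E * ennreal ((1 + ?v) * e)" by (rule mult_left_mono[OF int]) simp
  also have "\<dots> = ennreal (sob_const * (e powr (\<delta> / real n * q) * e))"
    using v e_nonneg by (simp add: E_def ennreal_mult[symmetric] sob_const_def q_def ac_simps)
  also have "e powr (\<delta> / real n * q) * e = (e powr (1 / p)) powr q"
  proof (cases "e = 0")
    case False
    have "e powr (\<delta> / real n * q) * e = e powr (\<delta> / real n * q + 1)"
      using False e_nonneg by (simp add: powr_add)
    also have "\<delta> / real n * q + 1 = 1 / p * q"
      using np n_pos p_ge_1 by (simp add: q_def field_simps)
    finally show ?thesis by (simp add: powr_powr)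
  qed simp
  finally show ?thesis by blast
qed

end

section \<open>From Lebesgue to Borel measurable functions\<close>

text \<open>The estimates above rest on Tonelli's theorem for Borel functions. A Borel function that agrees
  almost everywhere on \<open>D\<close> with a Lebesgue measurable one has the same energy and the same integrals.\<close>
lemma borel_representative:
  fixes u :: "'a::euclidean_space \<Rightarrow> real"
  assumes "u \<in> borel_measurable (lebesgue_on D)" "open D"
  obtains v where "v \<in> borel_measurable borel" "AE x in lborel. x \<in> D \<longrightarrow> u x = v x"
proof -
  have "(\<lambda>x. if x \<in> D then u x else 0) \<in> borel_measurable lebesgue"
    using assms by (simp add: borel_measurable_if_I)
  then obtain v where v: "v \<in> borel_measurable lborel" "AE x in lborel. (if x \<in> D then u x else 0) = v x"
    using completion_ex_borel_measurable_real by blast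
  show ?thesis
    by (rule that[of v]) (use v in \<open>auto elim!: eventually_mono\<close>)
qed

lemma frac_energy_representative:
  fixes u v :: "'a::euclidean_space \<Rightarrow> real"
  assumes D: "open D" and tau: "0 < \<tau>" "\<tau> \<le> 1" and uv: "AE x in lborel. x \<in> D \<longrightarrow> u x = v x"
  shows "frac_energy \<delta> p \<tau> D u = (\<integral>\<^sup>+x\<in>D. inner_energy \<delta> p \<tau> D v x \<partial>lborel)"
proof -
  have inner: "(\<integral>\<^sup>+y\<in>{y. near \<tau> D x y}.
        ennreal (\<bar>u x - u y\<bar> powr p / norm (x - y) powr (real DIM('a) + \<delta> * p)) \<partial>lborel)
      = inner_energy \<delta> p \<tau> D v x" if x: "x \<in> D" "u x = v x" for x
    unfolding inner_energy_def
    by (rule nn_integral_cong_AE)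
      (use uv near_in_domain[OF D x(1) _ tau(2)] in \<open>auto elim!: eventually_mono simp: indicator_def x(2)\<close>)
  show ?thesis
    unfolding frac_energy_def nn_integral_completion near_iff_boundary_dist[OF tau(1), symmetric]
  proof (rule nn_integral_cong_AE)
    show "AE x in lborel. (\<integral>\<^sup>+y\<in>{y. near \<tau> D x y}.
        ennreal (\<bar>u x - u y\<bar> powr p / norm (x - y) powr (real DIM('a) + \<delta> * p)) \<partial>lborel) * indicator D x
        = inner_energy \<delta> p \<tau> D v x * indicator D x"
      using uv
    proof eventually_elim
      case (elim x)
      then show ?case using inner[of x] by (cases "x \<in> D") simp_all
    qed
  qed
qed

theorem theorem5p1:
  fixes c \<tau> \<delta> p :: real
  assumes "CARD('n::finite) \<ge> 2"
    and "c \<ge> 1"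
    and "0 < \<tau>" "\<tau> < 1"
    and "0 < \<delta>" "\<delta> < 1"
    and "1 \<le> p" "p < real CARD('n) / \<delta>"
  shows "\<exists>C>0. \<forall>D :: (real ^ 'n) set. john_domain c D \<and> \<not> bounded D \<longrightarrow>
    (\<forall>u \<in> frac_sobolev \<delta> p \<tau> D.
       (INF a::real. \<integral>\<^sup>+x\<in>D. ennreal (\<bar>u x - a\<bar> powr
          (real CARD('n) * p / (real CARD('n) - \<delta> * p))) \<partial>lebesgue)
       \<le> ennreal (C * enn2real (frac_seminorm \<delta> p \<tau> D u) powr
          (real CARD('n) * p / (real CARD('n) - \<delta> * p))))"
proof -
  let ?n = "CARD('n)" and ?K = "3 * c\<^sup>2"
  let ?q = "real ?n * p / (real ?n - \<delta> * p)"
  have "1 * 1 \<le> 3 * c\<^sup>2" using assms(2) by (intro mult_mono) auto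
  then interpret frac_params ?n \<tau> \<delta> p ?K
    using assms by unfold_locales (auto simp: field_simps)
  show ?thesis
  proof (intro exI[of _ sob_const] conjI allI impI ballI sob_const_pos)
    fix D :: "(real ^ 'n) set" and u
    assume D: "john_domain c D \<and> \<not> bounded D" and u: "u \<in> frac_sobolev \<delta> p \<tau> D"
    have oD: "open D" using D by (simp add: john_domain_def)
    have "u \<in> borel_measurable (lebesgue_on D)" using u by (simp add: frac_sobolev_def)
    then obtain v where v: "v \<in> borel_measurable borel" "AE x in lborel. x \<in> D \<longrightarrow> u x = v x"
      using oD by (rule borel_representative)
    define e where "e = enn2real (frac_energy \<delta> p \<tau> D u)"
    have fin: "frac_energy \<delta> p \<tau> D u \<noteq> \<infinity>"
      using u by (auto simp: frac_sobolev_def frac_seminorm_def)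
    have semi: "enn2real (frac_seminorm \<delta> p \<tau> D u) = e powr (1 / p)"
      using fin by (simp add: frac_seminorm_def e_def)
    have en: "(\<integral>\<^sup>+x\<in>D. inner_energy \<delta> p \<tau> D v x \<partial>lborel) = ennreal e"
      using frac_energy_representative[OF oD _ _ v(2), of \<tau> \<delta> p] assms(3,4) fin
      by (simp add: e_def less_top)
    interpret frac_function ?n \<tau> \<delta> p ?K D v e
      by unfold_locales (use oD v en in \<open>auto simp: e_def\<close>)
    obtain a where a: "(\<integral>\<^sup>+x\<in>D. ennreal (\<bar>v x - a\<bar> powr ?q) \<partial>lborel) \<le> ennreal (sob_const * (e powr (1 / p)) powr ?q)"
      using sobolev_poincare[of c] D by auto
    have "(\<integral>\<^sup>+x\<in>D. ennreal (\<bar>u x - a\<bar> powr ?q) \<partial>lebesgue) = (\<integral>\<^sup>+x\<in>D. ennreal (\<bar>v x - a\<bar> powr ?q) \<partial>lborel)"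
      unfolding nn_integral_completion
      by (rule nn_integral_cong_AE) (use v(2) in \<open>auto elim!: eventually_mono simp: indicator_def\<close>)
    then show "(INF a::real. \<integral>\<^sup>+x\<in>D. ennreal (\<bar>u x - a\<bar> powr ?q) \<partial>lebesgue)
        \<le> ennreal (sob_const * enn2real (frac_seminorm \<delta> p \<tau> D u) powr ?q)"
      using a unfolding semi by (intro INF_lower2[of a]) auto
  qed
qed

end
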